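(* Let $L\in\mathbb{Z}^d$, $L\neq \mathbf{0}$, and let $f\in H^1(\mathbb{T}^d)$ be such that $\langle \mathcal{A}_L f, f\rangle\neq 0$. Then the directional uncertainty product $\mathrm{UP}^{\mathbb{T}^d}_L(f)$ is well-defined, and, with $c_k=c_k(f)$ denoting the Fourier coefficients of $f$, $$ \mathrm{UP}^{\mathbb{T}^d}_L(f) = \frac{1}{\|L\|^4} \left( \frac{\left(\sum_{k\in\mathbb{Z}^d} |c_k|^2\right)^2}{\left|\sum_{k\in\mathbb{Z}^d} c_{k-L}\overline{c_k}\right|^2} - 1 \right) \left( \frac{\sum_{k\in\mathbb{Z}^d} \langle L, k\rangle^2 |c_k|^2}{\sum_{k\in\mathbb{Z}^d} |c_k|^2} - \left(\frac{\sum_{k\in\mathbb{Z}^d} \langle L, k\rangle |c_k|^2}{\sum_{k\in\mathbb{Z}^d} |c_k|^2} \right)^2 \right) \ge \frac 14 . $$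
   Context: $\mathbb{T}^d=\mathbb{R}^d/\mathbb{Z}^d$; $\langle\cdot,\cdot\rangle$ and $\|\cdot\|$ on $\mathbb{R}^d$ are the Euclidean inner product and norm; $\|f\|_{\mathbb{T}^d}^2=\int_{\mathbb{T}^d}|f(x)|^2\,dx$ and $\langle f,g\rangle=\int_{\mathbb{T}^d}f\overline{g}\,dx$ on $L_2(\mathbb{T}^d)$. Fourier coefficients: $c_k(f)=\int_{\mathbb{T}^d} f(x)e^{-2\pi i\langle k,x\rangle}\,dx$, $k\in\mathbb{Z}^d$. $H^1(\mathbb{T}^d)=\{f\in L_2(\mathbb{T}^d):\sum_{k\in\mathbb{Z}^d}\|k\|^2|c_k(f)|^2<\infty\}$. For a direction $L=(L_1,\dots,L_d)\in\mathbb{Z}^d$, $L\ne\mathbf 0$, define the operators $\mathcal{A}_Lf(x)=e^{2\pi i\langle L,x\rangle}f(x)$ with domain $L_2(\mathbb{T}^d)$ and $\mathcal{B}_Lf(x)=\frac{i}{2\pi}\frac{\partial f}{\partial L}(x)$ with domain $H^1(\mathbb{T}^d)$, where $\frac{\partial f}{\partial L}=\sum_{j=1}^d L_j\frac{\partial f}{\partial x_j}$. The directional uncertainty product is $$\mathrm{UP}^{\mathbb{T}^d}_L(f)=\frac{1}{\|L\|^4}\left(\frac{\|f\|_{\mathbb{T}^d}^4}{|\langle\mathcal{A}_Lf,f\rangle|^2}-1\right)\left(\frac{\|\mathcal{B}_Lf\|_{\mathbb{T}^d}^2}{\|f\|_{\mathbb{T}^d}^2}-\frac{|\langle\mathcal{B}_Lf,f\rangle|^2}{\|f\|_{\mathbb{T}^d}^4}\right).$$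 *)

theory Defs
  imports "HOL-Analysis.Analysis"
begin

text \<open>
  Functions on the torus \<open>\<real>\<^sup>d / \<int>\<^sup>d\<close> are \<open>\<int>\<^sup>d\<close>-periodic functions on \<open>real^'d\<close>, with
  \<open>d = CARD('d)\<close>; they are integrated over the unit cube, a fundamental domain up to a
  null set. Elements of \<open>L\<^sub>2\<close> are represented by functions rather than by classes modulo
  almost everywhere equality.
\<close>

definition rvec :: "int^'d \<Rightarrow> real^'d" where
  "rvec k = (\<chi> i. real_of_int (k $ i))"

definition torus_measure :: "(real^'d) measure" where
  "torus_measure = lebesgue_on (cbox 0 1)"

definition periodic :: "(real^'d \<Rightarrow> complex) \<Rightarrow> bool" where
  "periodic f \<longleftrightarrow> (\<forall>x k. f (x + rvec k) = f x)"

definition L2_torus :: "(real^'d \<Rightarrow> complex) set" where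
  "L2_torus = {f. periodic f \<and> f \<in> borel_measurable torus_measure
      \<and> integrable torus_measure (\<lambda>x. (cmod (f x))\<^sup>2)}"

definition L2_inner :: "(real^'d \<Rightarrow> complex) \<Rightarrow> (real^'d \<Rightarrow> complex) \<Rightarrow> complex" where
  "L2_inner f g = (LINT x|torus_measure. f x * cnj (g x))"

definition L2_norm :: "(real^'d \<Rightarrow> complex) \<Rightarrow> real" where
  "L2_norm f = sqrt (LINT x|torus_measure. (cmod (f x))\<^sup>2)"

definition fourier_coeff :: "(real^'d \<Rightarrow> complex) \<Rightarrow> int^'d \<Rightarrow> complex" where
  "fourier_coeff f k =
     (LINT x|torus_measure. f x * exp (- 2 * complex_of_real pi * \<i> * complex_of_real (rvec k \<bullet> x)))"

definition H1_torus :: "(real^'d \<Rightarrow> complex) set" where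
  "H1_torus = {f \<in> L2_torus.
      (\<lambda>k. (norm (rvec k))\<^sup>2 * (cmod (fourier_coeff f k))\<^sup>2) summable_on UNIV}"

definition classical_partial :: "'d \<Rightarrow> (real^'d \<Rightarrow> complex) \<Rightarrow> real^'d \<Rightarrow> complex" where
  "classical_partial j \<phi> x = frechet_derivative \<phi> (at x) (axis j 1)"

primrec C_k :: "nat \<Rightarrow> (real^'d \<Rightarrow> complex) \<Rightarrow> bool" where
  "C_k 0 \<phi> \<longleftrightarrow> continuous_on UNIV \<phi>"
| "C_k (Suc n) \<phi> \<longleftrightarrow> (\<forall>x. \<phi> differentiable (at x)) \<and> (\<forall>j. C_k n (classical_partial j \<phi>))"

definition test_function :: "(real^'d \<Rightarrow> complex) \<Rightarrow> bool" where
  "test_function \<phi> \<longleftrightarrow> periodic \<phi> \<and> (\<forall>n. C_k n \<phi>)"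

text \<open>
  For \<open>f\<close> in \<open>H\<^sup>1\<close> the derivatives \<open>\<partial>f/\<partial>x\<^sub>j\<close> are the weak (distributional) derivatives on
  the torus, which are elements of \<open>L\<^sub>2\<close> and thus only determined up to a null set;
  \<open>weak_partial\<close> selects a representative.
\<close>

definition has_weak_partial :: "'d \<Rightarrow> (real^'d \<Rightarrow> complex) \<Rightarrow> (real^'d \<Rightarrow> complex) \<Rightarrow> bool" where
  "has_weak_partial j f g \<longleftrightarrow> g \<in> L2_torus \<and>
     (\<forall>\<phi>. test_function \<phi> \<longrightarrow>
        (LINT x|torus_measure. f x * classical_partial j \<phi> x) = - (LINT x|torus_measure. g x * \<phi> x))"

definition weak_partial :: "'d \<Rightarrow> (real^'d \<Rightarrow> complex) \<Rightarrow> real^'d \<Rightarrow> complex" where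
  "weak_partial j f = (SOME g. has_weak_partial j f g)"

definition dir_deriv :: "int^'d \<Rightarrow> (real^'d \<Rightarrow> complex) \<Rightarrow> real^'d \<Rightarrow> complex" where
  "dir_deriv L f x = (\<Sum>j\<in>UNIV. of_int (L $ j) * weak_partial j f x)"

definition op_A :: "int^'d \<Rightarrow> (real^'d \<Rightarrow> complex) \<Rightarrow> real^'d \<Rightarrow> complex" where
  "op_A L f x = exp (2 * complex_of_real pi * \<i> * complex_of_real (rvec L \<bullet> x)) * f x"

definition op_B :: "int^'d \<Rightarrow> (real^'d \<Rightarrow> complex) \<Rightarrow> real^'d \<Rightarrow> complex" where
  "op_B L f x = \<i> / (2 * complex_of_real pi) * dir_deriv L f x"

definition UP :: "int^'d \<Rightarrow> (real^'d \<Rightarrow> complex) \<Rightarrow> real" where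
  "UP L f = 1 / norm (rvec L) ^ 4
     * (L2_norm f ^ 4 / (cmod (L2_inner (op_A L f) f))\<^sup>2 - 1)
     * ((L2_norm (op_B L f))\<^sup>2 / (L2_norm f)\<^sup>2
        - (cmod (L2_inner (op_B L f) f))\<^sup>2 / L2_norm f ^ 4)"

text \<open>
  Well-definedness of the uncertainty product at \<open>f\<close>: the partial derivatives entering
  \<open>op_B L f\<close> exist and are unique up to null sets, all integrals converge, no denominator
  vanishes, and the value depends only on the class of \<open>f\<close> modulo null sets.
\<close>

definition UP_well_defined :: "int^'d \<Rightarrow> (real^'d \<Rightarrow> complex) \<Rightarrow> bool" where
  "UP_well_defined L f \<longleftrightarrow>
     (\<forall>j. \<exists>g. has_weak_partial j f g) \<and>
     (\<forall>j g h. has_weak_partial j f g \<longrightarrow> has_weak_partial j f h \<longrightarrow>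
        (AE x in torus_measure. g x = h x)) \<and>
     f \<in> L2_torus \<and> op_A L f \<in> L2_torus \<and> op_B L f \<in> L2_torus \<and>
     integrable torus_measure (\<lambda>x. op_A L f x * cnj (f x)) \<and>
     integrable torus_measure (\<lambda>x. op_B L f x * cnj (f x)) \<and>
     norm (rvec L) \<noteq> 0 \<and> L2_norm f \<noteq> 0 \<and> L2_inner (op_A L f) f \<noteq> 0 \<and>
     (\<forall>f'\<in>L2_torus. (AE x in torus_measure. f' x = f x) \<longrightarrow> UP L f' = UP L f)"

end

theory Submission
  imports Defs
begin

text \<open>
  By completeness of the characters (Stone--Weierstrass, applied on the image of the torus under
  \<open>x \<mapsto> (e\<^sup>2\<^sup>\<pi>\<^sup>i\<^sup>x\<^sup>j)\<^sub>j\<close>) and the Riesz--Fischer theorem, weak derivatives of \<open>f\<close> exist and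
  \<open>\<A>\<^sub>L\<close> shifts Fourier coefficients by \<open>L\<close> while \<open>\<B>\<^sub>L\<close> multiplies them by \<open>-\<langle>L,k\<rangle>\<close>; Parseval's
  identity then gives the formula. For the lower bound let \<open>u, v, D\<close> be the components of
  \<open>\<A>\<^sub>L f\<close>, \<open>\<A>\<^sub>L\<^sup>* f\<close>, \<open>\<B>\<^sub>L f\<close> orthogonal to \<open>f\<close>. Since the mean of \<open>\<B>\<^sub>L\<close> is real, the commutator relation
  becomes \<open>\<parallel>L\<parallel>\<^sup>2 \<langle>\<A>\<^sub>L f, f\<rangle> = \<langle>D, v\<rangle> - \<langle>u, D\<rangle>\<close>, and \<open>\<parallel>u\<parallel> = \<parallel>v\<parallel>\<close>, so Cauchy--Schwarz
  bounds it by \<open>2 \<parallel>u\<parallel> \<parallel>D\<parallel>\<close>.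
\<close>

subsection \<open>Square integrable functions on the torus\<close>

lemma rvec_simps [simp]:
  "rvec 0 = 0" "rvec (k + l) = rvec k + rvec l" "rvec (k - l) = rvec k - rvec l" "rvec (- k) = - rvec k"
  "rvec k $ i = of_int (k $ i)"
  by (simp_all add: rvec_def vec_eq_iff)

lemma rvec_inner_rvec: "rvec k \<bullet> rvec l = of_int (\<Sum>i\<in>UNIV. k $ i * l $ i)"
  by (simp add: inner_vec_def)

lemma rvec_eq_0_iff: "rvec k = 0 \<longleftrightarrow> k = 0"
  by (simp add: vec_eq_iff)

lemma space_torus [simp]: "space torus_measure = cbox 0 1"
  by (simp add: torus_measure_def)

lemma emeasure_torus: "emeasure (torus_measure :: (real^'d) measure) (space torus_measure) = 1"
proof -
  have *: "emeasure lborel (cbox 0 (1 :: real^'d)) = ennreal (measure lborel (cbox 0 (1 :: real^'d)))"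
    by (intro emeasure_eq_ennreal_measure) (simp add: emeasure_lborel_cbox_eq)
  have "measure lborel (cbox 0 (1 :: real^'d)) = 1"
    by (subst content_cbox_cart) (auto simp: interval_eq_empty_cart)
  with * show ?thesis
    by (simp add: torus_measure_def emeasure_restrict_space)
qed

interpretation torus: finite_measure "torus_measure :: (real^'d) measure"
  by standard (simp only: emeasure_torus, simp)

lemma measure_torus: "measure (torus_measure :: (real^'d) measure) (cbox 0 1) = 1"
  using emeasure_torus[where 'd='d] by (simp add: measure_def)

lemma borel_measurable_torus:
  assumes "g \<in> borel_measurable borel"
  shows "g \<in> borel_measurable torus_measure"
  unfolding torus_measure_def using assms
  by (intro measurable_restrict_space1 measurable_completion) simp

lemma continuous_measurable_torus:
  assumes "continuous_on UNIV g"
  shows "g \<in> borel_measurable torus_measure"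
  using assms by (intro borel_measurable_torus borel_measurable_continuous_onI)

text \<open>Passes to the gauge integral, in which shifts, cuts of boxes and differentiation under
  the integral sign are carried out below.\<close>

lemma integral_torus:
  fixes g :: "real^'d \<Rightarrow> 'b::euclidean_space"
  assumes "integrable torus_measure g"
  shows "(LINT x|torus_measure. g x) = integral (cbox 0 1) g"
  using assms unfolding torus_measure_def by (intro lebesgue_integral_eq_integral) auto

lemma continuous_bounded_torus:
  fixes g :: "real^'d \<Rightarrow> 'b::real_normed_vector"
  assumes "continuous_on UNIV g"
  obtains B where "B > 0" "\<And>x. x \<in> cbox 0 1 \<Longrightarrow> norm (g x) \<le> B"
proof -
  have "compact (g ` cbox 0 1)"
    using assms by (intro compact_continuous_image) (auto intro: continuous_on_subset)
  from compact_imp_bounded[OF this] show ?thesis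
    unfolding bounded_pos using that by blast
qed

lemma integrable_torus_continuous:
  fixes g :: "real^'d \<Rightarrow> 'b::{banach, second_countable_topology}"
  assumes "continuous_on UNIV g"
  shows "integrable torus_measure g"
proof -
  obtain B where B: "\<And>x. x \<in> cbox 0 1 \<Longrightarrow> norm (g x) \<le> B"
    using continuous_bounded_torus[OF assms] by metis
  show ?thesis
    by (rule torus.integrable_const_bound[where B = B])
       (use B assms in \<open>auto intro!: AE_I2 continuous_measurable_torus\<close>)
qed

section \<open>Closure properties of \<open>L2_torus\<close>\<close>

lemma L2_torusI:
  "periodic f \<Longrightarrow> f \<in> borel_measurable torus_measure \<Longrightarrow>
    integrable torus_measure (\<lambda>x. (cmod (f x))\<^sup>2) \<Longrightarrow> f \<in> L2_torus"
  by (simp add: L2_torus_def)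

lemma L2_torusD:
  assumes "f \<in> L2_torus"
  shows "periodic f" "f \<in> borel_measurable torus_measure"
    "integrable torus_measure (\<lambda>x. (cmod (f x))\<^sup>2)"
  using assms by (auto simp: L2_torus_def)

lemma L2_continuous:
  assumes "periodic f" "continuous_on UNIV f"
  shows "f \<in> L2_torus"
  using assms by (intro L2_torusI continuous_measurable_torus integrable_torus_continuous continuous_intros)

text \<open>Domination by \<open>|f|^2 + |g|^2\<close>, which bounds even
  \<open>2 |f| |g|\<close>.\<close>

lemma L2_integrable_mult:
  assumes "f \<in> L2_torus" "g \<in> L2_torus"
  shows "integrable torus_measure (\<lambda>x. f x * g x)"
proof (rule Bochner_Integration.integrable_bound)
  show "integrable torus_measure (\<lambda>x. (cmod (f x))\<^sup>2 + (cmod (g x))\<^sup>2)"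
    using assms by (simp add: L2_torusD)
  show "(\<lambda>x. f x * g x) \<in> borel_measurable torus_measure"
    using assms L2_torusD(2) by (intro borel_measurable_times) auto
  have "norm (f x * g x) \<le> norm ((cmod (f x))\<^sup>2 + (cmod (g x))\<^sup>2)" for x
  proof -
    have "norm (f x * g x) \<le> (cmod (f x))\<^sup>2 + (cmod (g x))\<^sup>2"
      using sum_squares_bound[of "cmod (f x)" "cmod (g x)"]
        mult_nonneg_nonneg[of "cmod (f x)" "cmod (g x)"]
      by (simp add: norm_mult del: zero_le_mult_iff mult_nonneg_nonneg)
    then show ?thesis by simp
  qed
  then show "AE x in torus_measure. norm (f x * g x) \<le> norm ((cmod (f x))\<^sup>2 + (cmod (g x))\<^sup>2)"
    by simp
qed

lemma L2_cnj:
  assumes "f \<in> L2_torus"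
  shows "(\<lambda>x. cnj (f x)) \<in> L2_torus"
proof (rule L2_torusI)
  show "(\<lambda>x. cnj (f x)) \<in> borel_measurable torus_measure"
    by (rule measurable_compose[OF L2_torusD(2)[OF assms]])
       (intro borel_measurable_continuous_onI continuous_intros)
qed (use L2_torusD[OF assms] in \<open>auto simp: periodic_def\<close>)

lemma L2_integrable_inner:
  assumes "f \<in> L2_torus" "g \<in> L2_torus"
  shows "integrable torus_measure (\<lambda>x. f x * cnj (g x))"
  using L2_integrable_mult[OF assms(1) L2_cnj[OF assms(2)]] .

lemma L2_scale:
  assumes "f \<in> L2_torus"
  shows "(\<lambda>x. a * f x) \<in> L2_torus"
  using L2_torusD[OF assms]
  by (intro L2_torusI) (auto simp: periodic_def norm_mult power_mult_distrib)

lemma L2_add: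
  assumes "f \<in> L2_torus" "g \<in> L2_torus"
  shows "(\<lambda>x. f x + g x) \<in> L2_torus"
proof (rule L2_torusI)
  show "periodic (\<lambda>x. f x + g x)"
    using assms[THEN L2_torusD(1)] by (simp add: periodic_def)
  have [measurable]: "f \<in> borel_measurable torus_measure" "g \<in> borel_measurable torus_measure"
    using assms L2_torusD(2) by auto
  show "(\<lambda>x. f x + g x) \<in> borel_measurable torus_measure"
    by measurable
  show "integrable torus_measure (\<lambda>x. (cmod (f x + g x))\<^sup>2)"
  proof (rule Bochner_Integration.integrable_bound)
    show "integrable torus_measure (\<lambda>x. 2 * (cmod (f x))\<^sup>2 + 2 * (cmod (g x))\<^sup>2)"
      using assms by (simp add: L2_torusD)
    have "norm ((cmod (f x + g x))\<^sup>2) \<le> norm (2 * (cmod (f x))\<^sup>2 + 2 * (cmod (g x))\<^sup>2)" for x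
    proof -
      have "(cmod (f x + g x))\<^sup>2 \<le> (cmod (f x) + cmod (g x))\<^sup>2"
        by (intro power_mono norm_triangle_ineq) auto
      also have "\<dots> \<le> 2 * (cmod (f x))\<^sup>2 + 2 * (cmod (g x))\<^sup>2"
        using sum_squares_bound[of "cmod (f x)" "cmod (g x)"]
        by (simp add: power2_sum)
      finally show ?thesis by simp
    qed
    then show "AE x in torus_measure. norm ((cmod (f x + g x))\<^sup>2)
        \<le> norm (2 * (cmod (f x))\<^sup>2 + 2 * (cmod (g x))\<^sup>2)"
      by simp
  qed simp
qed

lemma L2_diff:
  assumes "f \<in> L2_torus" "g \<in> L2_torus"
  shows "(\<lambda>x. f x - g x) \<in> L2_torus"
  using L2_add[OF assms(1) L2_scale[OF assms(2), of "-1"]] by simp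

lemma L2_zero: "(\<lambda>x. 0) \<in> L2_torus"
  by (rule L2_continuous) (auto simp: periodic_def)

lemma L2_sum:
  assumes "\<And>i. i \<in> I \<Longrightarrow> f i \<in> L2_torus"
  shows "(\<lambda>x. \<Sum>i\<in>I. f i x) \<in> L2_torus"
  using assms by (induction I rule: infinite_finite_induct) (auto simp: L2_zero L2_add)

text \<open>Pair with the constant 1, which is square integrable because the cube has finite
  measure.\<close>

lemma L2_integrable:
  assumes "f \<in> L2_torus"
  shows "integrable torus_measure f"
  using L2_integrable_mult[OF assms L2_continuous[of "\<lambda>_. 1"]] by (simp add: periodic_def)

section \<open>Inner product and norm\<close>

lemma L2_inner_cnj: "cnj (L2_inner f g) = L2_inner g f"
  unfolding L2_inner_def by (simp flip: Bochner_Integration.integral_cnj add: mult.commute)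

lemma L2_inner_diff_left:
  assumes "f \<in> L2_torus" "g \<in> L2_torus" "h \<in> L2_torus"
  shows "L2_inner (\<lambda>x. f x - g x) h = L2_inner f h - L2_inner g h"
  unfolding L2_inner_def using assms by (simp add: left_diff_distrib L2_integrable_inner)

lemma L2_inner_scale_left: "L2_inner (\<lambda>x. a * f x) h = a * L2_inner f h"
  unfolding L2_inner_def by (simp add: mult.assoc)

lemma L2_inner_diff_right:
  assumes "f \<in> L2_torus" "g \<in> L2_torus" "h \<in> L2_torus"
  shows "L2_inner h (\<lambda>x. f x - g x) = L2_inner h f - L2_inner h g"
  using L2_inner_diff_left[OF assms] by (simp flip: L2_inner_cnj[of _ h])

lemma L2_inner_scale_right: "L2_inner h (\<lambda>x. a * f x) = cnj a * L2_inner h f"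
  using L2_inner_scale_left[of a f h] by (simp flip: L2_inner_cnj[of _ h])

lemma L2_inner_sum_left:
  assumes "\<And>i. i \<in> I \<Longrightarrow> f i \<in> L2_torus" "h \<in> L2_torus"
  shows "L2_inner (\<lambda>x. \<Sum>i\<in>I. f i x) h = (\<Sum>i\<in>I. L2_inner (f i) h)"
  unfolding L2_inner_def using assms
  by (simp add: sum_distrib_right L2_integrable_inner)

lemma L2_norm_sq: "(L2_norm f)\<^sup>2 = (LINT x|torus_measure. (cmod (f x))\<^sup>2)"
  unfolding L2_norm_def by (simp add: integral_nonneg_AE)

lemma L2_norm_nonneg [simp]: "L2_norm f \<ge> 0"
  unfolding L2_norm_def by (simp add: integral_nonneg_AE)

lemma L2_inner_self: "L2_inner f f = complex_of_real ((L2_norm f)\<^sup>2)"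
  unfolding L2_norm_sq L2_inner_def complex_norm_square[symmetric] integral_complex_of_real[symmetric]
  by simp

lemma L2_norm_eq_0_iff:
  assumes "f \<in> L2_torus"
  shows "L2_norm f = 0 \<longleftrightarrow> (AE x in torus_measure. f x = 0)"
proof -
  have "L2_norm f = 0 \<longleftrightarrow> (LINT x|torus_measure. (cmod (f x))\<^sup>2) = 0"
    by (simp flip: L2_norm_sq)
  also have "\<dots> \<longleftrightarrow> (AE x in torus_measure. f x = 0)"
    using assms by (subst integral_nonneg_eq_0_iff_AE) (auto simp: L2_torusD)
  finally show ?thesis .
qed

lemma L2_inner_cong_AE:
  assumes "f \<in> L2_torus" "g \<in> L2_torus" "h \<in> L2_torus" "AE x in torus_measure. f x = g x"
  shows "L2_inner f h = L2_inner g h"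
  unfolding L2_inner_def
  by (rule integral_cong_AE) (use assms in \<open>auto simp: L2_integrable_inner intro!: borel_measurable_integrable\<close>)

lemma L2_norm_cong_AE:
  assumes "f \<in> L2_torus" "g \<in> L2_torus" "AE x in torus_measure. f x = g x"
  shows "L2_norm f = L2_norm g"
  unfolding L2_norm_def
  by (rule arg_cong[where f = sqrt], rule integral_cong_AE)
     (use assms in \<open>auto simp: L2_torusD intro!: borel_measurable_integrable\<close>)

text \<open>Serves as the polarisation identity that turns Parseval's identity for norms into one
  for inner products.\<close>

lemma L2_norm_diff_sq:
  assumes "f \<in> L2_torus" "g \<in> L2_torus"
  shows "(L2_norm (\<lambda>x. f x - g x))\<^sup>2 = (L2_norm f)\<^sup>2 + (L2_norm g)\<^sup>2 - 2 * Re (L2_inner f g)"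
proof -
  have "complex_of_real ((L2_norm (\<lambda>x. f x - g x))\<^sup>2) =
     L2_inner f f - L2_inner f g - (cnj (L2_inner f g) - L2_inner g g)"
    unfolding L2_inner_self[symmetric]
    using assms by (simp add: L2_inner_diff_left L2_inner_diff_right L2_diff L2_inner_cnj)
  from arg_cong[OF this, of Re] show ?thesis
    by (simp add: L2_inner_self flip: of_real_power)
qed

text \<open>Expand \<open>0 \<le> \<parallel>\<parallel>g\<parallel>\<^sup>2 f - \<langle>f,g\<rangle> g\<parallel>\<^sup>2\<close>.\<close>
lemma L2_Cauchy_Schwarz:
  assumes f: "f \<in> L2_torus" and g: "g \<in> L2_torus"
  shows "cmod (L2_inner f g) \<le> L2_norm f * L2_norm g"
proof (cases "L2_norm g = 0")
  case True
  then have "AE x in torus_measure. g x = 0"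
    using L2_norm_eq_0_iff g by blast
  then have "L2_inner g f = L2_inner (\<lambda>_. 0) f"
    using f g by (intro L2_inner_cong_AE) (auto simp: L2_zero)
  then have "L2_inner f g = 0"
    using L2_inner_cnj[of g f] by (simp add: L2_inner_def)
  then show ?thesis using True by simp
next
  case False
  define N where "N = (L2_norm g)\<^sup>2"
  have N: "N > 0" using False by (simp add: N_def)
  define w where "w = L2_inner f g"
  have "0 \<le> (L2_norm (\<lambda>x. complex_of_real N * f x - w * g x))\<^sup>2" by simp
  also have "\<dots> = N * (N * (L2_norm f)\<^sup>2 - (cmod w)\<^sup>2)"
  proof -
    have "complex_of_real ((L2_norm (\<lambda>x. complex_of_real N * f x - w * g x))\<^sup>2)
      = of_real N * of_real N * L2_inner f f - of_real N * (cnj w * w)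
        - (of_real N * w * cnj w - w * cnj w * L2_inner g g)"
      unfolding L2_inner_self[symmetric]
      using f g by (subst L2_inner_diff_left L2_inner_diff_right,
          simp_all add: L2_diff L2_scale L2_inner_diff_right L2_inner_scale_left L2_inner_scale_right
            flip: w_def L2_inner_cnj[of f g])
        (simp add: algebra_simps)
    also have "\<dots> = of_real (N * (N * (L2_norm f)\<^sup>2 - (cmod w)\<^sup>2))"
      by (simp add: L2_inner_self N_def[symmetric] complex_norm_square algebra_simps flip: of_real_power)
    finally show ?thesis by (simp only: of_real_eq_iff)
  qed
  finally have "(cmod w)\<^sup>2 \<le> (L2_norm f * L2_norm g)\<^sup>2"
    using N by (simp add: zero_le_mult_iff N_def power_mult_distrib mult.commute)
  then show ?thesis
    unfolding w_def by (rule power2_le_imp_le) simp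
qed

subsection \<open>Integration by parts and orthonormality of the characters\<close>

lemma rvec_axis: "rvec (axis j 1) = axis j 1"
  by (simp add: rvec_def vec_eq_iff axis_def)

text \<open>The shifted cube loses a slab of thickness \<open>t\<close> at the bottom and gains one
  at the top in direction \<open>j\<close>; by periodicity both slabs carry the same
  integral.\<close>

lemma integral_torus_translate:
  fixes \<psi> :: "real^'d \<Rightarrow> complex"
  assumes cont: "continuous_on UNIV \<psi>" and per: "periodic \<psi>" and t: "0 \<le> t" "t \<le> 1"
  shows "integral (cbox 0 1) (\<lambda>x. \<psi> (x + t *\<^sub>R axis j 1)) = integral (cbox 0 1) \<psi>"
proof -
  let ?e = "axis j 1 :: real^'d"
  have int: "\<psi> integrable_on cbox a b" for a b
    by (rule integrable_continuous[OF continuous_on_subset[OF cont]]) simp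
  have e: "?e \<in> Basis" by (simp add: axis_in_Basis_iff)
  have e_nth: "(t *\<^sub>R ?e) $ i = (if i = j then t else 0)" "?e $ i = (if i = j then 1 else 0)" for i t
    by (auto simp: axis_def)
  have inner_e: "x \<bullet> ?e = x $ j" for x
    by (simp add: inner_axis)
  have mem_j: "x \<in> cbox a b \<longleftrightarrow> (a $ j \<le> x $ j \<and> x $ j \<le> b $ j) \<and>
      (\<forall>i. i \<noteq> j \<longrightarrow> a $ i \<le> x $ i \<and> x $ i \<le> b $ i)" for x a b :: "real^'d"
    unfolding mem_box_cart by metis
  \<comment> \<open>The box containing both cubes is cut once at height 1 and once at height
    \<open>t\<close>. The corner \<open>1 + t *\<^sub>R ?e - ?e\<close> has \<open>j\<close>-th
    coordinate \<open>t\<close>, so it bounds the bottom slab.\<close>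
  have box: "cbox 0 (1 + t *\<^sub>R ?e) \<inter> {x. x \<bullet> ?e \<le> 1} = cbox 0 1"
            "cbox 0 (1 + t *\<^sub>R ?e) \<inter> {x. x \<bullet> ?e \<ge> 1} = cbox ?e (1 + t *\<^sub>R ?e)"
            "cbox 0 (1 + t *\<^sub>R ?e) \<inter> {x. x \<bullet> ?e \<ge> t} = cbox (t *\<^sub>R ?e) (1 + t *\<^sub>R ?e)"
            "cbox 0 (1 + t *\<^sub>R ?e) \<inter> {x. x \<bullet> ?e \<le> t} = cbox 0 (1 + t *\<^sub>R ?e - ?e)"
    unfolding inner_e using t by (auto simp: mem_j e_nth)
  have "integral (cbox 0 (1 + t *\<^sub>R ?e - ?e)) \<psi> = integral (cbox 0 (1 + t *\<^sub>R ?e - ?e)) (\<lambda>x. \<psi> (x + ?e))"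
    using per by (simp add: periodic_def flip: rvec_axis)
  also have "\<dots> = integral (cbox ?e (1 + t *\<^sub>R ?e)) \<psi>"
    using integral_shift_cbox[of ?e ?e "1 + t *\<^sub>R ?e" \<psi>] by simp
  finally have slab: "integral (cbox 0 (1 + t *\<^sub>R ?e - ?e)) \<psi> = integral (cbox ?e (1 + t *\<^sub>R ?e)) \<psi>" .
  have "integral (cbox 0 1) (\<lambda>x. \<psi> (x + t *\<^sub>R ?e)) = integral (cbox (t *\<^sub>R ?e) (1 + t *\<^sub>R ?e)) \<psi>"
    using integral_shift_cbox[of "t *\<^sub>R ?e" "t *\<^sub>R ?e" "1 + t *\<^sub>R ?e" \<psi>] by simp
  \<comment> \<open>The two cuts express the same integral as cube plus top slab and as bottom slab
    plus shifted cube; the slabs cancel.\<close>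
  also have "\<dots> = integral (cbox 0 1) \<psi>"
    using integral_split[OF int e, of 0 "1 + t *\<^sub>R ?e" 1]
      integral_split[OF int e, of 0 "1 + t *\<^sub>R ?e" t]
    unfolding box by (simp add: slab)
  finally show ?thesis .
qed

text \<open>The chain rule along a line, within an arbitrary \<open>S\<close> so that it also covers
  the endpoint of a parameter interval.\<close>

lemma classical_partial_along_axis:
  fixes \<phi> :: "real^'d \<Rightarrow> complex"
  assumes "\<phi> differentiable (at (x + t *\<^sub>R axis j 1))"
  shows "((\<lambda>t. \<phi> (x + t *\<^sub>R axis j 1)) has_vector_derivative
           classical_partial j \<phi> (x + t *\<^sub>R axis j 1)) (at t within S)"
proof -
  let ?e = "axis j 1 :: real^'d"
  let ?D = "frechet_derivative \<phi> (at (x + t *\<^sub>R ?e))"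
  have D: "(\<phi> has_derivative ?D) (at (x + t *\<^sub>R ?e))"
    using assms frechet_derivative_works by blast
  then interpret bounded_linear ?D by (rule has_derivative_bounded_linear)
  have "((\<lambda>t. x + t *\<^sub>R ?e) has_derivative (\<lambda>h. h *\<^sub>R ?e)) (at t within S)"
    by (auto intro!: derivative_eq_intros)
  from has_derivative_compose[OF this D]
  show ?thesis
    by (simp add: has_vector_derivative_def classical_partial_def scale)
qed

text \<open>The integral of a translate of \<open>\<psi>\<close> does not depend on the translation
  parameter \<open>t\<close>; differentiating under the integral sign at \<open>t = 0\<close> gives
  the claim. This is the source of every integration by parts below.\<close>

lemma integral_classical_partial:
  fixes \<psi> :: "real^'d \<Rightarrow> complex"
  assumes per: "periodic \<psi>" and diff: "\<And>x. \<psi> differentiable (at x)"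
    and cont: "continuous_on UNIV (classical_partial j \<psi>)"
  shows "(LINT x|torus_measure. classical_partial j \<psi> x) = 0"
proof -
  let ?e = "axis j 1 :: real^'d"
  let ?I = "\<lambda>t. integral (cbox 0 1) (\<lambda>x. \<psi> (x + t *\<^sub>R ?e))"
  have cont\<psi>: "continuous_on UNIV \<psi>"
    using diff by (simp add: continuous_on_eq_continuous_at differentiable_imp_continuous_within)
  \<comment> \<open>The derivative is one-sided at 0, since translation invariance is available for
    \<open>t\<close> in the unit interval; one-sided derivatives are unique as well.\<close>
  have "(?I has_vector_derivative
      integral (cbox 0 1) (\<lambda>x. classical_partial j \<psi> (x + 0 *\<^sub>R ?e))) (at 0 within cbox 0 1)"
  proof (rule leibniz_rule_vector_derivative)
    show "((\<lambda>t. \<psi> (x + t *\<^sub>R ?e)) has_vector_derivative classical_partial j \<psi> (x + t *\<^sub>R ?e))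
        (at t within cbox 0 1)" for x t
      by (rule classical_partial_along_axis[OF diff])
    show "(\<lambda>x. \<psi> (x + t *\<^sub>R ?e)) integrable_on cbox 0 1" for t
      by (intro integrable_continuous continuous_on_compose2[OF cont\<psi>] continuous_intros) auto
    show "continuous_on (cbox 0 1 \<times> cbox 0 1) (\<lambda>(t, x). classical_partial j \<psi> (x + t *\<^sub>R ?e))"
      unfolding case_prod_unfold
      by (intro continuous_on_compose2[OF cont] continuous_intros) auto
  qed auto
  moreover have "(?I has_vector_derivative 0) (at 0 within cbox 0 1)"
  proof (rule has_vector_derivative_transform)
    show "((\<lambda>_. integral (cbox 0 1) \<psi>) has_vector_derivative 0) (at 0 within cbox 0 1)"
      by simp
    show "?I t = integral (cbox 0 1) \<psi>" if "t \<in> cbox 0 1" for t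
      using that integral_torus_translate[OF cont\<psi> per] by simp
  qed simp
  ultimately have "integral (cbox 0 1) (\<lambda>x. classical_partial j \<psi> (x + 0 *\<^sub>R ?e)) = 0"
    by (rule vector_derivative_unique_within_closed_interval[rotated 2]) auto
  then show ?thesis
    using integral_torus[OF integrable_torus_continuous[OF cont]] by simp
qed

section \<open>Characters of the torus\<close>

definition echar :: "int^'d \<Rightarrow> real^'d \<Rightarrow> complex" where
  "echar k x = exp (2 * complex_of_real pi * \<i> * complex_of_real (rvec k \<bullet> x))"

lemma echar_eq_cis: "echar k x = cis (2 * pi * (rvec k \<bullet> x))"
  unfolding echar_def cis_conv_exp by (simp add: algebra_simps)

lemma echar_0 [simp]: "echar 0 x = 1"
  by (simp add: echar_def)

lemma echar_add: "echar (k + l) x = echar k x * echar l x"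
  by (simp add: echar_def inner_add_left distrib_left exp_add)

lemma cnj_echar: "cnj (echar k x) = echar (- k) x"
  by (simp add: echar_eq_cis cis_cnj)

lemma norm_echar [simp]: "cmod (echar k x) = 1"
  by (simp add: echar_eq_cis)

lemma periodic_echar: "periodic (echar k)"
  unfolding periodic_def
proof (intro allI)
  fix x l
  have "echar k (x + rvec l) = echar k x * cis (2 * pi * of_int (\<Sum>i\<in>UNIV. k $ i * l $ i))"
    by (simp only: echar_eq_cis inner_add_right rvec_inner_rvec distrib_left cis_mult)
  then show "echar k (x + rvec l) = echar k x"
    by (simp only: cis_multiple_2pi Ints_of_int mult_1_right)
qed

lemma continuous_echar [continuous_intros]: "continuous_on S (echar k)"
  unfolding echar_def by (intro continuous_intros)

lemma L2_echar: "echar k \<in> L2_torus"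
  by (intro L2_continuous periodic_echar continuous_echar)

lemma has_derivative_echar:
  "(echar k has_derivative (\<lambda>h. 2 * pi * \<i> * (rvec k \<bullet> h) * echar k x)) (at x within S)"
proof -
  have "((\<lambda>x. 2 * complex_of_real pi * \<i> * complex_of_real (rvec k \<bullet> x)) has_derivative
      (\<lambda>h. 2 * complex_of_real pi * \<i> * complex_of_real (rvec k \<bullet> h))) (at x within S)"
    by (intro derivative_intros)
  from has_derivative_compose[OF this DERIV_exp[unfolded has_field_derivative_def]]
  show ?thesis
    unfolding echar_def by (simp add: mult.commute)
qed

lemma differentiable_echar: "echar k differentiable (at x)"
  using has_derivative_echar differentiable_def by blast

text \<open>The scalar \<open>a\<close> makes the multiples of one character a class closed under
  differentiation, so that smoothness follows by induction on the order with \<open>a\<close>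
  arbitrary.\<close>

lemma classical_partial_echar:
  "classical_partial j (\<lambda>x. a * echar k x) = (\<lambda>x. (2 * pi * \<i> * (k $ j) * a) * echar k x)"
proof
  fix x
  have "((\<lambda>x. a * echar k x) has_derivative (\<lambda>h. a * (2 * pi * \<i> * (rvec k \<bullet> h) * echar k x))) (at x)"
    by (intro derivative_intros has_derivative_echar)
  from frechet_derivative_at[OF this, symmetric]
  show "classical_partial j (\<lambda>x. a * echar k x) x = (2 * pi * \<i> * (k $ j) * a) * echar k x"
    by (simp add: classical_partial_def inner_axis)
qed

lemma test_function_echar: "test_function (echar k)"
proof -
  have "C_k n (\<lambda>x. a * echar k x)" for n a
  proof (induction n arbitrary: a)
    case 0
    show ?case by (auto intro!: continuous_intros)
  next
    case (Suc n)
    then show ?case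
      by (auto simp: classical_partial_echar differentiable_echar)
  qed
  from this[of _ 1] show ?thesis
    by (simp add: test_function_def periodic_echar)
qed

section \<open>Fourier coefficients of derivatives and orthonormality\<close>

lemma fourier_coeff_eq_inner: "fourier_coeff f k = L2_inner f (echar k)"
  unfolding fourier_coeff_def L2_inner_def cnj_echar by (simp add: echar_def)

lemma classical_partial_mult_echar:
  assumes "\<phi> differentiable (at x)"
  shows "classical_partial j (\<lambda>x. \<phi> x * echar k x) x =
    classical_partial j \<phi> x * echar k x + 2 * pi * \<i> * (k $ j) * (\<phi> x * echar k x)"
proof -
  have D: "(\<phi> has_derivative frechet_derivative \<phi> (at x)) (at x)"
    using assms frechet_derivative_works by blast
  from frechet_derivative_at[OF has_derivative_mult[OF D has_derivative_echar], symmetric]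
  show ?thesis by (simp add: classical_partial_def inner_axis algebra_simps)
qed

lemma test_functionD:
  assumes "test_function \<phi>"
  shows "periodic \<phi>" "\<phi> differentiable (at x)" "continuous_on UNIV \<phi>"
    "continuous_on UNIV (classical_partial j \<phi>)"
proof -
  have C: "C_k n \<phi>" for n using assms by (simp add: test_function_def)
  show "periodic \<phi>" using assms by (simp add: test_function_def)
  show "\<phi> differentiable (at x)" using C[of 1] by simp
  show "continuous_on UNIV \<phi>" using C[of 0] by simp
  show "continuous_on UNIV (classical_partial j \<phi>)" using C[of 1] by simp
qed

text \<open>A lattice translate of \<open>\<phi>\<close> is \<open>\<phi>\<close> itself, so the
  derivatives at both points agree by uniqueness.\<close>

lemma periodic_classical_partial:
  assumes "periodic \<phi>" "\<And>x. \<phi> differentiable (at x)"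
  shows "periodic (classical_partial j \<phi>)"
  unfolding periodic_def
proof (intro allI)
  fix x k
  have "(\<phi> has_derivative frechet_derivative \<phi> (at (x + rvec k))) (at (x + rvec k))"
    using assms(2) frechet_derivative_works by blast
  then have "((\<lambda>y. \<phi> (y + rvec k)) has_derivative frechet_derivative \<phi> (at (x + rvec k))) (at x)"
    by (rule has_derivative_compose[rotated]) (auto intro!: derivative_eq_intros)
  then have "frechet_derivative \<phi> (at (x + rvec k)) = frechet_derivative \<phi> (at x)"
    using assms(1) frechet_derivative_at by (fastforce simp: periodic_def)
  then show "classical_partial j \<phi> (x + rvec k) = classical_partial j \<phi> x"
    by (simp add: classical_partial_def)
qed

lemma L2_classical_partial: "test_function \<phi> \<Longrightarrow> classical_partial j \<phi> \<in> L2_torus"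
  by (intro L2_continuous periodic_classical_partial test_functionD)

lemma L2_test_function: "test_function \<phi> \<Longrightarrow> \<phi> \<in> L2_torus"
  by (intro L2_continuous test_functionD)

text \<open>Integration by parts: the partial derivative of \<open>\<phi>\<close> times the
  conjugate character integrates to 0, and the product rule splits it into the two sides.\<close>

lemma fourier_coeff_classical_partial:
  assumes \<phi>: "test_function \<phi>"
  shows "fourier_coeff (classical_partial j \<phi>) k = 2 * pi * \<i> * (k $ j) * fourier_coeff \<phi> k"
proof -
  note \<phi>' = test_functionD[OF \<phi>]
  let ?\<psi> = "\<lambda>x. \<phi> x * echar (- k) x"
  have per: "periodic ?\<psi>"
    using \<phi>'(1) periodic_echar[of "-k"] by (simp add: periodic_def)
  have eq: "classical_partial j ?\<psi> = (\<lambda>x. classical_partial j \<phi> x * echar (- k) x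
      + (2 * pi * \<i> * ((- k) $ j)) * (\<phi> x * echar (- k) x))"
    using \<phi>'(2) by (intro ext) (rule classical_partial_mult_echar)
  have "0 = (LINT x|torus_measure. classical_partial j ?\<psi> x)"
  proof (rule integral_classical_partial[symmetric, OF per])
    show "?\<psi> differentiable (at x)" for x
      by (intro differentiable_mult \<phi>' differentiable_echar)
    show "continuous_on UNIV (classical_partial j ?\<psi>)"
      unfolding eq by (intro continuous_intros \<phi>')
  qed
  also have "\<dots> = fourier_coeff (classical_partial j \<phi>) k - 2 * pi * \<i> * (k $ j) * fourier_coeff \<phi> k"
    unfolding eq fourier_coeff_eq_inner L2_inner_def cnj_echar
    using L2_integrable_mult[OF L2_classical_partial[OF \<phi>] L2_echar]
      L2_integrable_mult[OF L2_test_function[OF \<phi>] L2_echar]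
    by simp
  finally show ?thesis by simp
qed

text \<open>Orthogonality needs no explicit integral: if \<open>k\<close> and \<open>l\<close>
  differ in coordinate \<open>j\<close>, the \<open>l\<close>-th coefficient of the
  \<open>j\<close>-th derivative of \<open>echar k\<close> is both \<open>2 pi i l_j\<close> and
  \<open>2 pi i k_j\<close> times the coefficient sought, which must vanish.\<close>

lemma fourier_coeff_echar: "fourier_coeff (echar k) l = (if k = l then 1 else 0)"
proof (cases "k = l")
  case True
  then show ?thesis
    by (simp add: fourier_coeff_eq_inner L2_inner_def complex_norm_square[symmetric] measure_torus)
next
  case False
  then obtain j where j: "k $ j \<noteq> l $ j" by (auto simp: vec_eq_iff)
  have "2 * pi * \<i> * (l $ j) * fourier_coeff (echar k) l = fourier_coeff (classical_partial j (echar k)) l"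
    by (simp add: fourier_coeff_classical_partial test_function_echar)
  also have "\<dots> = 2 * pi * \<i> * (k $ j) * fourier_coeff (echar k) l"
    using classical_partial_echar[of j 1 k] by (simp add: fourier_coeff_eq_inner L2_inner_scale_left)
  finally show ?thesis using j False by simp
qed

lemma fourier_coeff_diff:
  "f \<in> L2_torus \<Longrightarrow> g \<in> L2_torus \<Longrightarrow>
    fourier_coeff (\<lambda>x. f x - g x) k = fourier_coeff f k - fourier_coeff g k"
  by (simp add: fourier_coeff_eq_inner L2_inner_diff_left L2_echar)

lemma fourier_coeff_scale: "fourier_coeff (\<lambda>x. a * f x) k = a * fourier_coeff f k"
  by (simp add: fourier_coeff_eq_inner L2_inner_scale_left)

lemma fourier_coeff_cnj: "fourier_coeff (\<lambda>x. cnj (f x)) k = cnj (fourier_coeff f (- k))"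
proof -
  have "fourier_coeff (\<lambda>x. cnj (f x)) k = (LINT x|torus_measure. cnj (f x * cnj (echar (- k) x)))"
    by (simp add: fourier_coeff_eq_inner L2_inner_def cnj_echar)
  also have "\<dots> = cnj (fourier_coeff f (- k))"
    by (simp only: Bochner_Integration.integral_cnj fourier_coeff_eq_inner L2_inner_def)
  finally show ?thesis .
qed

subsection \<open>Completeness of the characters\<close>

text \<open>Generated by sums of single terms rather than given by coefficient families, so closure
  properties follow by rule induction without tracking frequencies.\<close>

inductive trig_poly :: "(real^'d \<Rightarrow> complex) \<Rightarrow> bool" where
  echar: "trig_poly (\<lambda>x. a * echar k x)"
| add: "trig_poly p \<Longrightarrow> trig_poly q \<Longrightarrow> trig_poly (\<lambda>x. p x + q x)"

lemma trig_poly_const: "trig_poly (\<lambda>x. a)"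
  using trig_poly.echar[of a 0] by simp

lemma trig_poly_mult:
  assumes "trig_poly p" "trig_poly q"
  shows "trig_poly (\<lambda>x. p x * q x)"
  using assms(1)
proof induction
  case (echar a k)
  from assms(2) show ?case
  proof induction
    case (echar b l)
    show ?case
      using trig_poly.echar[of "a * b" "k + l"] by (simp add: echar_add mult_ac)
  next
    case (add p q)
    then show ?case
      using trig_poly.add[of "\<lambda>x. a * echar k x * p x" "\<lambda>x. a * echar k x * q x"]
      by (simp add: distrib_left)
  qed
next
  case (add p p')
  then show ?case
    using trig_poly.add[of "\<lambda>x. p x * q x" "\<lambda>x. p' x * q x"] by (simp add: distrib_right)
qed

lemma trig_poly_sum:
  assumes "\<And>i. i \<in> I \<Longrightarrow> trig_poly (p i)"
  shows "trig_poly (\<lambda>x. \<Sum>i\<in>I. p i x)"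
  using assms
  by (induction I rule: infinite_finite_induct) (auto simp: trig_poly_const intro: trig_poly.add)

section \<open>The torus as a compact set in complex space\<close>

lemma sets_torus: "A \<in> sets torus_measure \<longleftrightarrow> A \<in> sets lebesgue \<and> A \<subseteq> cbox 0 1"
  by (auto simp: torus_measure_def sets_restrict_space_iff)

lemma closed_in_sets_lebesgue: "closed S \<Longrightarrow> S \<in> sets lebesgue"
  by (rule sets_completionI_sets) (simp add: borel_closed)

lemma AE_torus_iff: "(AE x in torus_measure. P x) \<longleftrightarrow> (AE x in lebesgue. x \<in> cbox 0 1 \<longrightarrow> P x)"
  unfolding torus_measure_def by (rule AE_restrict_space_iff) simp

text \<open>The faces of the cube are negligible. They must be discarded because opposite faces have
  the same image under the embedding defined next.\<close>

lemma AE_torus_box: "AE x in torus_measure. x \<in> box 0 (1 :: real^'d)"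
proof -
  have "cbox 0 1 - box 0 (1 :: real^'d) \<in> null_sets lebesgue"
    using negligible_frontier_interval[of 0 "1 :: real^'d"] by (simp only: negligible_iff_null_sets)
  from AE_not_in[OF this] show ?thesis
    unfolding AE_torus_iff by eventually_elim blast
qed

text \<open>The quotient map onto the product of unit circles. It turns polynomials on complex space
  into trigonometric polynomials, so that the Stone-Weierstrass theorem for polynomials
  applies.\<close>

definition torus_embed :: "real^'d \<Rightarrow> complex^'d" where
  "torus_embed x = (\<chi> j. echar (axis j 1) x)"

lemma continuous_torus_embed: "continuous_on S torus_embed"
  unfolding torus_embed_def by (intro continuous_intros)

lemma echar_axis: "echar (axis j 1) x = cis (2 * pi * (x $ j))"
  by (simp add: echar_eq_cis rvec_axis inner_axis')

text \<open>Equal images force each pair of coordinates to differ by an integer, and in the open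
  cube this integer has absolute value below 1.\<close>

lemma torus_embed_inj_on_box: "inj_on (torus_embed :: real^'d \<Rightarrow> complex^'d) (box 0 1)"
proof (rule inj_onI)
  fix x y :: "real^'d"
  assume x: "x \<in> box 0 1" and y: "y \<in> box 0 1" and eq: "torus_embed x = torus_embed y"
  have "x $ j = y $ j" for j
  proof -
    have "cis (2 * pi * (x $ j)) = cis (2 * pi * (y $ j))"
      using arg_cong[OF eq, of "\<lambda>z. z $ j"] by (simp add: torus_embed_def echar_axis)
    then have "cis (2 * pi * (x $ j) - 2 * pi * (y $ j)) = 1"
      by (simp flip: cis_divide)
    then have "cos (2 * pi * (x $ j) - 2 * pi * (y $ j)) = 1"
      by (simp add: complex_eq_iff)
    then obtain n :: int where "2 * pi * (x $ j) - 2 * pi * (y $ j) = n * 2 * pi"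
      by (auto simp: cos_one_2pi_int)
    then have "pi * (2 * (x $ j - y $ j - n)) = 0"
      by (simp add: algebra_simps)
    then have n: "x $ j - y $ j = n" by simp
    have "\<bar>x $ j - y $ j\<bar> < 1"
      using x y by (auto simp: mem_box_cart abs_less_iff) (smt (verit))+
    with n have "\<bar>n\<bar> < 1" by linarith
    with n show ?thesis by simp
  qed
  then show "x = y" by (simp add: vec_eq_iff)
qed

text \<open>A real linear functional combines the real and imaginary parts of the coordinates; on
  the unit circle these are combinations of a character and its conjugate, which is again a
  character.\<close>

lemma trig_poly_linear:
  assumes "bounded_linear (g :: complex^'d \<Rightarrow> real)"
  shows "trig_poly (\<lambda>x. complex_of_real (g (torus_embed x)))"
proof -
  interpret bounded_linear g by fact
  \<comment> \<open>Expansion in the real basis of complex space formed by the vectors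
    \<open>axis j 1\<close> and \<open>axis j \<i>\<close>.\<close>
  have g: "g z = (\<Sum>j\<in>UNIV. Re (z $ j) * g (axis j 1) + Im (z $ j) * g (axis j \<i>))" for z
  proof -
    have "z = (\<Sum>j\<in>UNIV. Re (z $ j) *\<^sub>R axis j 1 + Im (z $ j) *\<^sub>R axis j \<i>)"
      by (simp add: vec_eq_iff axis_def if_distrib[of "(*\<^sub>R) _"] sum.distrib complex_eq_iff cong: if_cong)
    then have "g z = g (\<Sum>j\<in>UNIV. Re (z $ j) *\<^sub>R axis j 1 + Im (z $ j) *\<^sub>R axis j \<i>)"
      by simp
    then show ?thesis by (simp add: sum add scale)
  qed
  have "complex_of_real (g (torus_embed x)) = (\<Sum>j\<in>UNIV.
     (((g (axis j 1) - \<i> * g (axis j \<i>)) / 2) * echar (axis j 1) x +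
      ((g (axis j 1) + \<i> * g (axis j \<i>)) / 2) * echar (- axis j 1) x))" for x
  proof -
    have "complex_of_real (Re w * a + Im w * b) = (a - \<i> * b) / 2 * w + (a + \<i> * b) / 2 * cnj w"
      for w a b by (simp add: complex_eq_iff field_simps)
    then show ?thesis
      by (subst g) (simp add: torus_embed_def cnj_echar[symmetric] del: of_real_add of_real_mult)
  qed
  then show ?thesis
    by (simp only:) (intro trig_poly_sum trig_poly.intros)
qed

text \<open>Linear functionals and constants generate the real polynomial functions under sums and
  products, and trigonometric polynomials are closed under both.\<close>

lemma trig_poly_real_polynomial:
  assumes "real_polynomial_function (q :: complex^'d \<Rightarrow> real)"
  shows "trig_poly (\<lambda>x. complex_of_real (q (torus_embed x)))"
  using assms
  by induction (auto intro: trig_poly_linear trig_poly_const trig_poly.add trig_poly_mult)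

lemma continuous_trig_poly: "trig_poly p \<Longrightarrow> continuous_on S p"
  by (induction rule: trig_poly.induct) (auto intro!: continuous_intros)

lemma integrable_mult_bounded_torus:
  assumes "f \<in> L2_torus" "q \<in> borel_measurable torus_measure"
    and "\<And>x. x \<in> cbox 0 1 \<Longrightarrow> cmod (q x) \<le> B"
  shows "integrable torus_measure (\<lambda>x. f x * q x)"
proof (rule Bochner_Integration.integrable_bound)
  show "integrable torus_measure (\<lambda>x. f x * of_real B)"
    using L2_integrable[OF assms(1)] by simp
  show "(\<lambda>x. f x * q x) \<in> borel_measurable torus_measure"
    using assms L2_torusD(2) by (intro borel_measurable_times) auto
  show "AE x in torus_measure. norm (f x * q x) \<le> norm (f x * of_real B)"
    using assms(3) by (intro AE_I2) (force simp: norm_mult intro!: mult_left_mono)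
qed

lemma integrable_mult_continuous_torus:
  assumes "f \<in> L2_torus" "continuous_on UNIV q"
  shows "integrable torus_measure (\<lambda>x. f x * q x)"
proof -
  obtain B where "\<And>x. x \<in> cbox 0 1 \<Longrightarrow> norm (q x) \<le> B"
    using continuous_bounded_torus[OF assms(2)] by metis
  then show ?thesis
    using assms by (intro integrable_mult_bounded_torus continuous_measurable_torus) auto
qed

section \<open>Functions all of whose Fourier coefficients vanish\<close>

context
  fixes f :: "real^'d \<Rightarrow> complex"
  assumes f: "f \<in> L2_torus" and coeff_0: "\<And>k. fourier_coeff f k = 0"
begin

lemma integral_trig_poly_eq_0:
  assumes "trig_poly p"
  shows "(LINT x|torus_measure. f x * p x) = 0"
  using assms
proof induction
  case (echar a k)
  have "(LINT x|torus_measure. f x * (a * echar k x)) = a * fourier_coeff f (- k)"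
    by (simp add: fourier_coeff_eq_inner L2_inner_def cnj_echar mult_ac flip: integral_mult_right_zero)
  then show ?case by (simp add: coeff_0)
next
  case (add p q)
  then show ?case
    using f by (simp add: distrib_left integrable_mult_continuous_torus continuous_trig_poly)
qed

text \<open>Replace \<open>h\<close> by a polynomial uniformly close to it on the compact image of
  the cube: the polynomial contributes 0, and the error is at most the uniform distance times the
  integral of \<open>|f|\<close>.\<close>

lemma integral_continuous_embed_eq_0:
  assumes h: "continuous_on UNIV (h :: complex^'d \<Rightarrow> real)"
  shows "(LINT x|torus_measure. f x * of_real (h (torus_embed x))) = 0"
proof -
  let ?I = "LINT x|torus_measure. f x * of_real (h (torus_embed x))"
  define A where "A = (LINT x|torus_measure. cmod (f x))"
  have A: "A \<ge> 0" by (simp add: A_def integral_nonneg_AE)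
  have "cmod ?I \<le> e" if "e > 0" for e
  proof -
    \<comment> \<open>Chosen so that \<open>d * A \<le> e\<close>; the added 1 keeps the denominator
      positive when \<open>A\<close> is 0.\<close>
    define d where "d = e / (A + 1)"
    have d: "d > 0" using A that by (simp add: d_def)
    have "compact (torus_embed ` (cbox 0 1 :: (real^'d) set))"
      by (intro compact_continuous_image continuous_torus_embed) simp
    then obtain q where q: "real_polynomial_function q"
      "\<And>z. z \<in> torus_embed ` (cbox 0 1 :: (real^'d) set) \<Longrightarrow> \<bar>h z - q z\<bar> < d"
      using Stone_Weierstrass_real_polynomial_function[OF _ continuous_on_subset[OF h subset_UNIV] d]
      by metis
    note tp = trig_poly_real_polynomial[OF q(1)]
    have int: "integrable torus_measure (\<lambda>x. f x * of_real (h (torus_embed x)))"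
        "integrable torus_measure (\<lambda>x. f x * of_real (q (torus_embed x)))"
      by (intro integrable_mult_continuous_torus f continuous_intros
          continuous_on_compose2[OF h] continuous_torus_embed continuous_trig_poly tp; simp)+
    have "?I = (LINT x|torus_measure. f x * of_real (h (torus_embed x)) - f x * of_real (q (torus_embed x)))"
      using int integral_trig_poly_eq_0[OF tp] by simp
    also have "cmod \<dots> \<le> (LINT x|torus_measure. d * cmod (f x))"
    proof (rule Bochner_Integration.integral_norm_bound_integral)
      show "integrable torus_measure (\<lambda>x. d * cmod (f x))"
        using L2_integrable[OF f] by simp
      show "norm (f x * of_real (h (torus_embed x)) - f x * of_real (q (torus_embed x))) \<le> d * cmod (f x)"
        if "x \<in> space torus_measure" for x
      proof -
        have "\<bar>h (torus_embed x) - q (torus_embed x)\<bar> \<le> d"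
          using q(2)[of "torus_embed x"] that by auto
        from mult_left_mono[OF this, of "cmod (f x)"] show ?thesis
          by (simp add: norm_mult mult.commute flip: right_diff_distrib of_real_diff)
      qed
    qed (use int in auto)
    also have "\<dots> = d * A" by (simp add: A_def)
    also have "\<dots> \<le> e"
      using A that by (simp add: d_def field_simps)
    finally show ?thesis .
  qed
  then have "cmod ?I \<le> 0" by (rule field_le_epsilon) simp
  then show ?thesis by simp
qed

text \<open>The indicator of the image of \<open>K\<close> is a pointwise limit of continuous
  cut-off functions, so dominated convergence carries the previous lemma over to
  \<open>K\<close>.\<close>

lemma integral_compact_eq_0:
  assumes K: "compact K" "K \<subseteq> box 0 1"
  shows "(LINT x|torus_measure. f x * indicator K x) = 0"
\<comment> \<open>The empty set is split off because \<open>infdist\<close> to it is 0 by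
  convention, which would make the cut-off functions constantly 1.\<close>
proof (cases "K = {}")
  case False
  define C where "C = torus_embed ` K"
  have C: "closed C" "C \<noteq> {}"
    using K(1) False continuous_torus_embed
    by (auto simp: C_def intro!: compact_imp_closed compact_continuous_image)
  \<comment> \<open>Equal to 1 on \<open>C\<close> and to 0 from distance \<open>1/n\<close>
    on.\<close>
  define h where "h n z = max 0 (1 - real n * infdist z C)" for n z
  have cont: "continuous_on S (h n)" for n S
    unfolding h_def by (intro continuous_intros)
  have h_bounds: "0 \<le> h n z" "h n z \<le> 1" for n z
    by (auto simp: h_def infdist_nonneg)
  have h_lim: "(\<lambda>n. h n z) \<longlonglongrightarrow> indicator C z" for z
  proof (cases "z \<in> C")
    case True
    then show ?thesis by (simp add: h_def)
  next
    case False
    then have pos: "infdist z C > 0"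
      using C by (metis in_closed_iff_infdist_zero infdist_nonneg less_le)
    obtain N :: nat where N: "1 / infdist z C < real N"
      using reals_Archimedean2 by blast
    have "h n z = 0" if "n \<ge> N" for n
    proof -
      have "1 / infdist z C \<le> real n" using N that by simp
      then show ?thesis using pos by (simp add: h_def field_simps)
    qed
    then have "\<forall>\<^sub>F n in sequentially. h n z = 0"
      by (auto simp: eventually_sequentially)
    then show ?thesis using False by (simp add: tendsto_eventually)
  qed
  have [measurable]: "f \<in> borel_measurable torus_measure" using f L2_torusD(2) by blast
  have K_meas [measurable]: "K \<in> sets torus_measure"
    using K box_subset_cbox[of 0 "1::real^'d"] compact_imp_closed[OF K(1)]
    unfolding sets_torus by (intro conjI closed_in_sets_lebesgue; blast)
  have hE [measurable]: "(\<lambda>x. h n (torus_embed x)) \<in> borel_measurable torus_measure" for n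
    by (intro continuous_measurable_torus continuous_on_compose2[OF cont] continuous_torus_embed) auto
  have "(\<lambda>n. LINT x|torus_measure. f x * of_real (h n (torus_embed x)))
      \<longlonglongrightarrow> (LINT x|torus_measure. f x * indicator K x)"
  proof (rule integral_dominated_convergence)
    show "integrable torus_measure (\<lambda>x. cmod (f x))"
      using L2_integrable[OF f] by simp
    show "AE x in torus_measure. (\<lambda>n. f x * of_real (h n (torus_embed x))) \<longlonglongrightarrow> f x * indicator K x"
      using AE_torus_box
    proof eventually_elim
      case (elim x)
      \<comment> \<open>Injectivity on the open cube ensures that no point outside \<open>K\<close>
        is mapped into \<open>C\<close>.\<close>
      have "torus_embed x \<in> C \<longleftrightarrow> x \<in> K"
        using elim K(2) torus_embed_inj_on_box by (auto simp: C_def dest: inj_onD)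
      then have "complex_of_real (indicator C (torus_embed x)) = indicator K x"
        by (simp add: indicator_def)
      then show ?case
        using h_lim[of "torus_embed x"] by (metis tendsto_mult_left tendsto_of_real)
    qed
    show "AE x in torus_measure. norm (f x * of_real (h n (torus_embed x))) \<le> cmod (f x)" for n
      using h_bounds by (intro AE_I2) (simp add: norm_mult mult_left_le)
  qed measurable
  moreover have "(LINT x|torus_measure. f x * of_real (h n (torus_embed x))) = 0" for n
    by (rule integral_continuous_embed_eq_0[OF cont])
  ultimately show ?thesis
    by (simp add: LIMSEQ_const_iff)
qed simp

text \<open>By inner regularity the set where \<open>Re f\<close> is positive is exhausted, up to
  small measure, by compact sets. The integral of \<open>f\<close> over each of these is 0, so each
  of them is a null set.\<close>

lemma AE_Re_le_0: "AE x in torus_measure. Re (f x) \<le> 0"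
proof -
  \<comment> \<open>Restricted to the open cube because \<open>integral_compact_eq_0\<close>
    concerns its compact subsets; \<open>AE_torus_box\<close> removes the restriction at the
    end.\<close>
  define P where "P = {x \<in> box 0 1. Re (f x) > 0}"
  have meas [measurable]: "f \<in> borel_measurable torus_measure" using f L2_torusD(2) by blast
  have "{x \<in> space torus_measure. Re (f x) > 0} \<in> sets torus_measure" by measurable
  then have "{x \<in> cbox 0 1. Re (f x) > 0} \<in> sets lebesgue"
    by (simp only: sets_torus space_torus)
  moreover have "box 0 1 \<in> sets (lebesgue :: (real^'d) measure)" by simp
  ultimately have "{x \<in> cbox 0 1. Re (f x) > 0} \<inter> box 0 1 \<in> sets lebesgue" by (rule sets.Int)
  also have "{x \<in> cbox 0 1. Re (f x) > 0} \<inter> box 0 1 = P"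
    using box_subset_cbox[of 0 "1::real^'d"] unfolding P_def by blast
  finally have P: "P \<in> sets lebesgue" .
  have small: "emeasure lebesgue P \<le> 0 + ennreal e" if "e > 0" for e
  proof -
    from sets_lebesgue_inner_closed[OF P that] obtain T where
      T: "closed T" "T \<subseteq> P" "P - T \<in> lmeasurable" "emeasure lebesgue (P - T) < ennreal e"
      by blast
    have Tbox: "T \<subseteq> box 0 1" using T by (auto simp: P_def)
    then have "compact T"
      using T(1) bounded_subset[OF bounded_box] by (simp add: compact_eq_bounded_closed)
    have TC: "T \<subseteq> cbox 0 1" using Tbox box_subset_cbox by blast
    have Ts: "T \<in> sets torus_measure"
      using TC T(1) by (simp add: sets_torus closed_in_sets_lebesgue)
    have int: "integrable torus_measure (\<lambda>x. f x * indicator T x)"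
      using Ts f by (intro integrable_mult_bounded_torus[of f _ 1] borel_measurable_indicator)
         (auto simp: indicator_def)
    have "(LINT x|torus_measure. Re (f x * indicator T x)) = Re (LINT x|torus_measure. f x * indicator T x)"
      using int by (rule integral_Re)
    also have "\<dots> = 0"
      using integral_compact_eq_0[OF \<open>compact T\<close> Tbox] by simp
    finally have "(LINT x|torus_measure. Re (f x * indicator T x)) = 0" .
    moreover have "0 \<le> Re (f x * indicator T x)" for x
      using T(2) by (auto simp: P_def indicator_def)
    ultimately have "AE x in torus_measure. Re (f x * indicator T x) = 0"
      using integral_nonneg_eq_0_iff_AE[OF integrable_Re[OF int]] by (simp del: times_complex.sel)
    \<comment> \<open>On \<open>T\<close> the integrand is strictly positive, so it can vanish only
      off \<open>T\<close>.\<close>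
    then have "AE x in torus_measure. x \<notin> T"
      by eventually_elim (use T(2) in \<open>auto simp: P_def indicator_def split: if_splits\<close>)
    then have "AE x in lebesgue. x \<notin> T"
      unfolding AE_torus_iff by eventually_elim (use TC in blast)
    then have "emeasure lebesgue T = 0"
      using T(1) by (subst (asm) AE_iff_measurable[OF _ refl]) auto
    then have "emeasure lebesgue P = emeasure lebesgue (P - T)"
      using T P emeasure_Diff_null_set[of T lebesgue P] by (auto simp: null_sets_def)
    then show ?thesis using T by simp
  qed
  have "emeasure lebesgue P \<le> 0"
    by (rule ennreal_le_epsilon) (rule small)
  then have "P \<in> null_sets lebesgue" using P by (simp add: null_sets_def)
  then have "AE x in lebesgue. x \<notin> P" by (rule AE_not_in)
  then have "AE x in torus_measure. x \<notin> P"
    unfolding AE_torus_iff by eventually_elim blast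
  with AE_torus_box show ?thesis
    by eventually_elim (auto simp: P_def)
qed

end

text \<open>The hypotheses are stable under scalar multiplication; the sign result for
  \<open>f\<close> times 1, -1, \<open>\<i>\<close> and \<open>-\<i>\<close> forces both real and
  imaginary part to vanish.\<close>

theorem fourier_coeff_complete:
  assumes f: "f \<in> L2_torus" and 0: "\<And>k. fourier_coeff f k = 0"
  shows "AE x in torus_measure. f x = 0"
proof -
  have *: "AE x in torus_measure. Re (a * f x) \<le> 0" for a
    using f 0 by (intro AE_Re_le_0) (simp_all add: L2_scale fourier_coeff_scale)
  from *[of 1] *[of "-1"] *[of \<i>] *[of "-\<i>"] show ?thesis
    by eventually_elim (auto simp: complex_eq_iff)
qed

subsection \<open>The Riesz--Fischer theorem and Parseval's identity\<close>

text \<open>The coefficients are an arbitrary family, since the Riesz-Fischer theorem starts from a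
  sequence and not from a function.\<close>

definition fourier_sum :: "(int^'d \<Rightarrow> complex) \<Rightarrow> (int^'d) set \<Rightarrow> real^'d \<Rightarrow> complex" where
  "fourier_sum a F x = (\<Sum>k\<in>F. a k * echar k x)"

lemma continuous_fourier_sum: "continuous_on S (fourier_sum a F)"
  unfolding fourier_sum_def by (intro continuous_intros)

lemma periodic_fourier_sum: "periodic (fourier_sum a F)"
  by (simp add: periodic_def fourier_sum_def periodic_echar[unfolded periodic_def, rule_format])

lemma L2_fourier_sum: "fourier_sum a F \<in> L2_torus"
  by (intro L2_continuous periodic_fourier_sum continuous_fourier_sum)

lemma inner_fourier_sum:
  assumes "f \<in> L2_torus"
  shows "L2_inner (fourier_sum a F) f = (\<Sum>k\<in>F. a k * cnj (fourier_coeff f k))"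
proof -
  have "L2_inner (fourier_sum a F) f = (\<Sum>k\<in>F. L2_inner (\<lambda>x. a k * echar k x) f)"
    unfolding fourier_sum_def[abs_def] using assms by (intro L2_inner_sum_left L2_scale L2_echar)
  then show ?thesis
    by (simp add: L2_inner_scale_left fourier_coeff_eq_inner L2_inner_cnj)
qed

lemma fourier_coeff_fourier_sum:
  assumes "finite F"
  shows "fourier_coeff (fourier_sum a F) k = (if k \<in> F then a k else 0)"
  using assms
  by (simp add: fourier_coeff_eq_inner[of _ k] inner_fourier_sum L2_echar fourier_coeff_echar
      if_distrib[of cnj] if_distrib[of "(*) _"] cong: if_cong)

lemma L2_norm_fourier_sum:
  assumes "finite F"
  shows "(L2_norm (fourier_sum a F))\<^sup>2 = (\<Sum>k\<in>F. (cmod (a k))\<^sup>2)"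
proof -
  have "complex_of_real ((L2_norm (fourier_sum a F))\<^sup>2) = (\<Sum>k\<in>F. a k * cnj (a k))"
    unfolding L2_inner_self[symmetric] inner_fourier_sum[OF L2_fourier_sum]
    using assms by (simp add: fourier_coeff_fourier_sum)
  also have "\<dots> = complex_of_real (\<Sum>k\<in>F. (cmod (a k))\<^sup>2)"
    by (simp add: complex_norm_square del: of_real_power)
  finally show ?thesis by (simp only: of_real_eq_iff)
qed

text \<open>Pythagoras for the orthogonal projection onto the span of the characters in
  \<open>F\<close>. It gives Bessel's inequality, and Parseval's identity once the left side is
  known to become small.\<close>

lemma L2_norm_diff_fourier_sum:
  assumes "finite F" "f \<in> L2_torus"
  shows "(L2_norm (\<lambda>x. f x - fourier_sum (fourier_coeff f) F x))\<^sup>2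
    = (L2_norm f)\<^sup>2 - (\<Sum>k\<in>F. (cmod (fourier_coeff f k))\<^sup>2)"
proof -
  have "L2_inner f (fourier_sum (fourier_coeff f) F) = cnj (\<Sum>k\<in>F. (cmod (fourier_coeff f k))\<^sup>2)"
    unfolding L2_inner_cnj[of "fourier_sum _ _" f, symmetric] inner_fourier_sum[OF assms(2)]
    by (simp add: complex_norm_square mult.commute del: of_real_power)
  then have "Re (L2_inner f (fourier_sum (fourier_coeff f) F)) = (\<Sum>k\<in>F. (cmod (fourier_coeff f k))\<^sup>2)"
    by (metis Re_complex_of_real complex_cnj_complex_of_real)
  then show ?thesis
    using assms by (simp add: L2_norm_diff_sq L2_fourier_sum L2_norm_fourier_sum)
qed

text \<open>Cauchy-Schwarz for \<open>|f|\<close> against the constant character, whose norm is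
  1.\<close>

lemma integral_cmod_le_L2_norm:
  fixes f :: "real^'d \<Rightarrow> complex"
  assumes "f \<in> L2_torus"
  shows "(LINT x|torus_measure. cmod (f x)) \<le> L2_norm f"
proof -
  define h where "h = (\<lambda>x. complex_of_real (cmod (f x)))"
  have h: "h \<in> L2_torus"
    using L2_torusD[OF assms] by (auto simp: L2_torus_def h_def periodic_def)
  have "(LINT x|torus_measure. cmod (f x)) = cmod (L2_inner h (echar 0))"
    by (simp add: L2_inner_def h_def integral_nonneg_AE)
  also have "\<dots> \<le> L2_norm h * L2_norm (echar 0 :: real^'d \<Rightarrow> complex)"
    by (intro L2_Cauchy_Schwarz h L2_echar)
  also have "\<dots> = L2_norm f"
    by (simp add: L2_norm_def h_def measure_torus)
  finally show ?thesis .
qed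

section \<open>Completeness of \<open>L2_torus\<close>\<close>

lemma nn_integral_cmod_sq:
  assumes "f \<in> L2_torus"
  shows "(\<integral>\<^sup>+x. ennreal ((cmod (f x))\<^sup>2) \<partial>torus_measure) = ennreal ((L2_norm f)\<^sup>2)"
  using L2_torusD(3)[OF assms] by (simp add: L2_norm_sq nn_integral_eq_integral)

lemma convergent_if_summable_diff:
  fixes s :: "nat \<Rightarrow> 'a::banach"
  assumes "summable (\<lambda>n. norm (s (Suc n) - s n))"
  shows "convergent s"
proof -
  have "summable (\<lambda>n. s (Suc n) - s n)"
    using assms by (rule summable_norm_cancel)
  then have "convergent (\<lambda>n. s n - s 0)"
    unfolding summable_iff_convergent sum_lessThan_telescope .
  then show ?thesis
    using convergent_diff_const_right_iff by blast
qed

text \<open>The norms of the increments have a finite sum, so the telescoping series converges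
  absolutely almost everywhere; Fatou's lemma passes the norm bounds to the limit.\<close>

lemma L2_complete:
  assumes S: "\<And>n. S n \<in> L2_torus"
    and fast: "\<And>m n. n \<le> m \<Longrightarrow> L2_norm (\<lambda>x. S m x - S n x) \<le> C * (1/2) ^ n"
  obtains g where "g \<in> L2_torus" "\<And>n. L2_norm (\<lambda>x. g x - S n x) \<le> C * (1/2) ^ n"
proof -
  \<comment> \<open>Defined at every point, with the fixed default value of \<open>lim\<close> where
    the sequence diverges, so that periodicity and measurability hold without an exceptional
    set.\<close>
  define g where "g x = lim (\<lambda>n. S n x)" for x
  have S_meas [measurable]: "S n \<in> borel_measurable torus_measure" for n
    using S L2_torusD(2) by blast
  have g_meas [measurable]: "g \<in> borel_measurable torus_measure"
    unfolding g_def[abs_def] by measurable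
  have g_per: "periodic g"
    using S[THEN L2_torusD(1)] by (simp add: periodic_def g_def)
  have C: "C \<ge> 0"
    using fast[of 0 0] order_trans[OF L2_norm_nonneg] by fastforce
  have "AE x in torus_measure. (\<Sum>n. ennreal (cmod (S (Suc n) x - S n x))) \<noteq> \<infinity>"
  proof (rule nn_integral_PInf_AE)
    have "(\<integral>\<^sup>+x. (\<Sum>n. ennreal (cmod (S (Suc n) x - S n x))) \<partial>torus_measure)
        = (\<Sum>n. \<integral>\<^sup>+x. ennreal (cmod (S (Suc n) x - S n x)) \<partial>torus_measure)"
      by (rule nn_integral_suminf) measurable
    also have "\<dots> \<le> (\<Sum>n. ennreal (C * (1/2) ^ n))"
    proof (rule suminf_le)
      fix n
      have D: "(\<lambda>x. S (Suc n) x - S n x) \<in> L2_torus" by (intro L2_diff S)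
      have "(\<integral>\<^sup>+x. ennreal (cmod (S (Suc n) x - S n x)) \<partial>torus_measure)
          = ennreal (LINT x|torus_measure. cmod (S (Suc n) x - S n x))"
        using L2_integrable[OF D] by (intro nn_integral_eq_integral) auto
      also have "\<dots> \<le> ennreal (C * (1/2) ^ n)"
        using integral_cmod_le_L2_norm[OF D] fast[of n "Suc n"] by (intro ennreal_leI) simp
      finally show "(\<integral>\<^sup>+x. ennreal (cmod (S (Suc n) x - S n x)) \<partial>torus_measure) \<le> ennreal (C * (1/2) ^ n)" .
    qed auto
    also have "\<dots> < top"
      unfolding less_top[symmetric]
      by (intro ennreal_suminf_neq_top summable_mult summable_geometric) (use C in auto)
    finally show "(\<integral>\<^sup>+x. (\<Sum>n. ennreal (cmod (S (Suc n) x - S n x))) \<partial>torus_measure) \<noteq> \<infinity>"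
      by simp
  qed measurable
  then have lim: "AE x in torus_measure. (\<lambda>n. S n x) \<longlonglongrightarrow> g x"
  proof eventually_elim
    case (elim x)
    then have "summable (\<lambda>n. cmod (S (Suc n) x - S n x))"
      by (intro summable_suminf_not_top) auto
    from convergent_if_summable_diff[OF this] show ?case
      by (simp add: g_def convergent_LIMSEQ_iff)
  qed
  have bound: "(\<integral>\<^sup>+x. ennreal ((cmod (g x - S n x))\<^sup>2) \<partial>torus_measure) \<le> ennreal ((C * (1/2) ^ n)\<^sup>2)" for n
  proof -
    have "(\<integral>\<^sup>+x. ennreal ((cmod (g x - S n x))\<^sup>2) \<partial>torus_measure)
        = (\<integral>\<^sup>+x. liminf (\<lambda>m. ennreal ((cmod (S m x - S n x))\<^sup>2)) \<partial>torus_measure)"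
    proof (rule nn_integral_cong_AE, use lim in eventually_elim)
      case (elim x)
      then have "(\<lambda>m. ennreal ((cmod (S m x - S n x))\<^sup>2)) \<longlonglongrightarrow> ennreal ((cmod (g x - S n x))\<^sup>2)"
        by (intro tendsto_intros) auto
      then show ?case by (rule lim_imp_Liminf[symmetric, rotated]) simp
    qed
    also have "\<dots> \<le> liminf (\<lambda>m. \<integral>\<^sup>+x. ennreal ((cmod (S m x - S n x))\<^sup>2) \<partial>torus_measure)"
      by (rule nn_integral_liminf) measurable
    also have "\<dots> \<le> limsup (\<lambda>m. \<integral>\<^sup>+x. ennreal ((cmod (S m x - S n x))\<^sup>2) \<partial>torus_measure)"
      by (rule Liminf_le_Limsup) simp
    also have "\<dots> \<le> ennreal ((C * (1/2) ^ n)\<^sup>2)"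
    proof (rule Limsup_bounded, rule eventually_sequentiallyI)
      fix m assume "n \<le> m"
      then show "(\<integral>\<^sup>+x. ennreal ((cmod (S m x - S n x))\<^sup>2) \<partial>torus_measure) \<le> ennreal ((C * (1/2) ^ n)\<^sup>2)"
        unfolding nn_integral_cmod_sq[OF L2_diff[OF S S]]
        by (intro ennreal_leI power_mono fast) auto
    qed
    finally show ?thesis .
  qed
  have gS: "(\<lambda>x. g x - S n x) \<in> L2_torus" for n
  proof (rule L2_torusI)
    show "periodic (\<lambda>x. g x - S n x)"
      using g_per S[THEN L2_torusD(1), of n] by (simp add: periodic_def)
    show "integrable torus_measure (\<lambda>x. (cmod (g x - S n x))\<^sup>2)"
      using le_less_trans[OF bound ennreal_less_top] by (intro integrableI_nonneg) auto
  qed measurable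
  have "g \<in> L2_torus"
    using L2_add[OF gS[of 0] S[of 0]] by simp
  moreover have "L2_norm (\<lambda>x. g x - S n x) \<le> C * (1/2) ^ n" for n
  proof (rule power2_le_imp_le)
    show "(L2_norm (\<lambda>x. g x - S n x))\<^sup>2 \<le> (C * (1/2) ^ n)\<^sup>2"
      using bound[of n] unfolding nn_integral_cmod_sq[OF gS] by (simp add: ennreal_le_iff)
  qed (use C in simp)
  ultimately show ?thesis by (rule that)
qed

text \<open>Partial sums over finite sets that exhaust the series fast enough satisfy
  \<open>L2_complete\<close>. The approximation clause is recorded for the proof of Parseval's
  identity.\<close>

theorem Riesz_Fischer:
  fixes a :: "int^'d \<Rightarrow> complex"
  assumes summ: "(\<lambda>k. (cmod (a k))\<^sup>2) summable_on UNIV"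
  obtains g where "g \<in> L2_torus" "fourier_coeff g = a"
    "\<And>e. e > 0 \<Longrightarrow> \<exists>F. finite F \<and> L2_norm (\<lambda>x. g x - fourier_sum a F x) < e"
proof -
  define s where "s = (\<Sum>\<^sub>\<infinity>k. (cmod (a k))\<^sup>2)"
  have sum_le: "(\<Sum>k\<in>F. (cmod (a k))\<^sup>2) \<le> s" if "finite F" for F
    unfolding s_def using that by (intro finite_sum_le_infsum summ) auto
  \<comment> \<open>The tolerance \<open>(1/4) ^ n\<close> is the square of the rate
    \<open>(1/2) ^ n\<close> required by \<open>L2_complete\<close>.\<close>
  have "\<exists>F. finite F \<and> s - (1/4) ^ n < (\<Sum>k\<in>F. (cmod (a k))\<^sup>2)" for n :: nat
  proof (rule ccontr)
    assume "\<not> ?thesis"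
    then have "s \<le> s - (1/4) ^ n"
      unfolding s_def by (intro infsum_le_finite_sums summ) (auto simp: not_less)
    then show False
      using zero_less_power[of "1/4 :: real" n] by linarith
  qed
  then obtain G where G: "\<And>n. finite (G n)" "\<And>n::nat. s - (1/4) ^ n < (\<Sum>k\<in>G n. (cmod (a k))\<^sup>2)"
    by metis
  \<comment> \<open>Unions make the finite sets increasing, so differences of partial sums are again
    Fourier sums.\<close>
  define F where "F n = (\<Union>i\<le>n. G i)" for n
  have fin: "finite (F n)" for n using G(1) by (simp add: F_def)
  have mono: "F n \<subseteq> F m" if "n \<le> m" for n m using that by (force simp: F_def)
  have F: "s - (1/4) ^ n < (\<Sum>k\<in>F n. (cmod (a k))\<^sup>2)" for n
  proof -
    have "(\<Sum>k\<in>G n. (cmod (a k))\<^sup>2) \<le> (\<Sum>k\<in>F n. (cmod (a k))\<^sup>2)"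
      using fin by (intro sum_mono2) (auto simp: F_def)
    with G(2)[of n] show ?thesis by simp
  qed
  have quarter: "(1/4 :: real) ^ n = ((1/2) ^ n)\<^sup>2" for n
    by (simp add: power_divide power_mult_distrib power2_eq_square flip: power_mult_distrib)
  have tail: "(\<Sum>k\<in>H. (cmod (a k))\<^sup>2) \<le> ((1/2) ^ n)\<^sup>2" if "finite H" "H \<inter> F n = {}" for H n
  proof -
    have "(\<Sum>k\<in>H. (cmod (a k))\<^sup>2) + (\<Sum>k\<in>F n. (cmod (a k))\<^sup>2) = (\<Sum>k\<in>H \<union> F n. (cmod (a k))\<^sup>2)"
      using that fin by (simp add: sum.union_disjoint)
    also have "\<dots> \<le> s" using that fin by (intro sum_le) simp
    finally show ?thesis using F[of n] quarter[of n] by linarith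
  qed
  have fast: "L2_norm (\<lambda>x. fourier_sum a (F m) x - fourier_sum a (F n) x) \<le> 1 * (1/2) ^ n"
    if "n \<le> m" for m n
  proof -
    have "(\<lambda>x. fourier_sum a (F m) x - fourier_sum a (F n) x) = fourier_sum a (F m - F n)"
      using mono[OF that] fin by (auto simp: fourier_sum_def sum_diff)
    moreover have "L2_norm (fourier_sum a (F m - F n)) \<le> (1/2) ^ n"
      by (rule power2_le_imp_le) (use fin in \<open>auto simp: L2_norm_fourier_sum intro!: tail\<close>)
    ultimately show ?thesis by simp
  qed
  obtain g where g: "g \<in> L2_torus" "\<And>n. L2_norm (\<lambda>x. g x - fourier_sum a (F n) x) \<le> 1 * (1/2) ^ n"
    using L2_complete[OF L2_fourier_sum fast] by metis
  have small: "\<exists>n. (1/2 :: real) ^ n < e" if "e > 0" for e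
    using that by (intro real_arch_pow_inv) auto
  have "fourier_coeff g k = a k" for k
  proof -
    \<comment> \<open>One error \<open>(1/2) ^ n\<close> comes from replacing \<open>g\<close> by
      its partial sum, the other from the possible absence of \<open>k\<close> in
      \<open>F n\<close>, in which case \<open>k\<close> belongs to the tail.\<close>
    have bound: "cmod (fourier_coeff g k - a k) \<le> 2 * (1/2) ^ n" for n
    proof -
      have "fourier_coeff g k - fourier_coeff (fourier_sum a (F n)) k
          = L2_inner (\<lambda>x. g x - fourier_sum a (F n) x) (echar k)"
        using g by (simp add: fourier_coeff_eq_inner L2_inner_diff_left L2_fourier_sum L2_echar)
      also have "cmod \<dots> \<le> L2_norm (\<lambda>x. g x - fourier_sum a (F n) x) * L2_norm (echar k)"
        using g by (intro L2_Cauchy_Schwarz L2_diff L2_fourier_sum L2_echar)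
      also have "\<dots> \<le> (1/2) ^ n"
        using g(2)[of n] by (simp add: L2_norm_def[of "echar k"] measure_torus)
      finally have 1: "cmod (fourier_coeff g k - (if k \<in> F n then a k else 0)) \<le> (1/2) ^ n"
        by (simp add: fourier_coeff_fourier_sum[OF fin])
      have "cmod ((if k \<in> F n then a k else 0) - a k) \<le> (1/2) ^ n"
        using tail[of "{k}" n] by (auto intro: power2_le_imp_le)
      with norm_triangle_mono[OF 1 this] show ?thesis by simp
    qed
    have "\<not> 0 < cmod (fourier_coeff g k - a k)"
    proof
      assume "0 < cmod (fourier_coeff g k - a k)"
      then obtain n where "(1/2 :: real) ^ n < cmod (fourier_coeff g k - a k) / 2"
        using small[of "cmod (fourier_coeff g k - a k) / 2"] by auto
      with bound[of n] show False by linarith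
    qed
    then show ?thesis by simp
  qed
  then have coeff: "fourier_coeff g = a" by auto
  show ?thesis
  proof (rule that[OF g(1) coeff])
    fix e :: real assume "e > 0"
    then obtain n where "(1/2) ^ n < e" using small by blast
    then show "\<exists>F. finite F \<and> L2_norm (\<lambda>x. g x - fourier_sum a F x) < e"
      using g(2)[of n] fin[of n] by (intro exI[of _ "F n"]) auto
  qed
qed

section \<open>Uniqueness and Parseval's identity\<close>

lemma fourier_coeff_unique:
  assumes "f \<in> L2_torus" "g \<in> L2_torus" "fourier_coeff f = fourier_coeff g"
  shows "AE x in torus_measure. f x = g x"
proof -
  have "AE x in torus_measure. f x - g x = 0"
    using assms by (intro fourier_coeff_complete) (auto simp: L2_diff fourier_coeff_diff)
  then show ?thesis by simp
qed

text \<open>Bessel's inequality gives one direction. For the other, Riesz-Fischer yields a function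
  with the same coefficients that is approximated by its Fourier sums, and completeness identifies
  it with \<open>f\<close> almost everywhere.\<close>

theorem Parseval:
  assumes f: "f \<in> L2_torus"
  shows "((\<lambda>k. (cmod (fourier_coeff f k))\<^sup>2) has_sum (L2_norm f)\<^sup>2) UNIV"
proof -
  let ?c = "fourier_coeff f"
  have Bessel: "(\<Sum>k\<in>F. (cmod (?c k))\<^sup>2) \<le> (L2_norm f)\<^sup>2" if "finite F" for F
    using L2_norm_diff_fourier_sum[OF that f] by (metis diff_ge_0_iff_ge zero_le_power2)
  have summ: "(\<lambda>k. (cmod (?c k))\<^sup>2) summable_on UNIV"
    by (rule nonneg_bounded_partial_sums_imp_summable_on[where C = "(L2_norm f)\<^sup>2"])
       (auto intro!: eventually_finite_subsets_at_top_weakI Bessel)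
  obtain g where g: "g \<in> L2_torus" "fourier_coeff g = ?c"
    "\<And>e. e > 0 \<Longrightarrow> \<exists>F. finite F \<and> L2_norm (\<lambda>x. g x - fourier_sum ?c F x) < e"
    using Riesz_Fischer[OF summ] by metis
  have fg: "AE x in torus_measure. g x = f x"
    using g f by (intro fourier_coeff_unique) auto
  let ?s = "\<Sum>\<^sub>\<infinity>k. (cmod (?c k))\<^sup>2"
  have "?s \<le> (L2_norm f)\<^sup>2"
    using Bessel by (intro infsum_le_finite_sums summ) auto
  moreover have "(L2_norm f)\<^sup>2 \<le> ?s"
  proof (rule field_le_epsilon)
    fix e :: real assume "e > 0"
    then obtain F where F: "finite F" "L2_norm (\<lambda>x. g x - fourier_sum ?c F x) < sqrt e"
      using g(3)[of "sqrt e"] by auto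
    have "L2_norm (\<lambda>x. g x - fourier_sum ?c F x) = L2_norm (\<lambda>x. f x - fourier_sum ?c F x)"
      using fg g f by (intro L2_norm_cong_AE L2_diff L2_fourier_sum) auto
    then have "(L2_norm (\<lambda>x. f x - fourier_sum ?c F x))\<^sup>2 < (sqrt e)\<^sup>2"
      using F by (intro power_strict_mono) auto
    then have "(L2_norm f)\<^sup>2 < (\<Sum>k\<in>F. (cmod (?c k))\<^sup>2) + e"
      using \<open>e > 0\<close> by (simp add: L2_norm_diff_fourier_sum[OF F(1) f])
    also have "(\<Sum>k\<in>F. (cmod (?c k))\<^sup>2) \<le> ?s"
      using F(1) by (intro finite_sum_le_infsum summ) auto
    finally show "(L2_norm f)\<^sup>2 \<le> ?s + e" by simp
  qed
  ultimately show ?thesis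
    using has_sum_infsum[OF summ] by simp
qed

text \<open>Polarisation: apply \<open>Parseval\<close> to \<open>f\<close>, \<open>g\<close> and
  \<open>f - g\<close>.\<close>

lemma Parseval_Re:
  assumes "f \<in> L2_torus" "g \<in> L2_torus"
  shows "((\<lambda>k. Re (fourier_coeff f k * cnj (fourier_coeff g k))) has_sum Re (L2_inner f g)) UNIV"
proof -
  have eq: "Re (a * cnj b) = 1/2 * ((cmod a)\<^sup>2 + (cmod b)\<^sup>2 + (-1) * (cmod (a - b))\<^sup>2)" for a b
    unfolding cmod_power2 by (simp add: power2_eq_square algebra_simps)
  have "((\<lambda>k. 1/2 * ((cmod (fourier_coeff f k))\<^sup>2 + (cmod (fourier_coeff g k))\<^sup>2
          + (-1) * (cmod (fourier_coeff f k - fourier_coeff g k))\<^sup>2))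
      has_sum 1/2 * ((L2_norm f)\<^sup>2 + (L2_norm g)\<^sup>2 + (-1) * (L2_norm (\<lambda>x. f x - g x))\<^sup>2)) UNIV"
    using assms Parseval[OF L2_diff[OF assms]]
    by (intro has_sum_cmult_right has_sum_add Parseval) (simp_all add: fourier_coeff_diff)
  also have "1/2 * ((L2_norm f)\<^sup>2 + (L2_norm g)\<^sup>2 + (-1) * (L2_norm (\<lambda>x. f x - g x))\<^sup>2) = Re (L2_inner f g)"
    using assms by (simp add: L2_norm_diff_sq)
  finally show ?thesis unfolding eq .
qed

text \<open>Replacing \<open>g\<close> by \<open>\<i>\<close> times \<open>g\<close> turns the real
  part of each product into its imaginary part.\<close>

theorem Parseval_inner:
  assumes f: "f \<in> L2_torus" and g: "g \<in> L2_torus"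
  shows "((\<lambda>k. fourier_coeff f k * cnj (fourier_coeff g k)) has_sum L2_inner f g) UNIV"
proof -
  have "((\<lambda>k. Re (fourier_coeff f k * cnj (\<i> * fourier_coeff g k))) has_sum Re (cnj \<i> * L2_inner f g)) UNIV"
    using Parseval_Re[OF f L2_scale[OF g, of \<i>]]
    unfolding L2_inner_scale_right fourier_coeff_scale .
  then have Im: "((\<lambda>k. Im (fourier_coeff f k * cnj (fourier_coeff g k))) has_sum Im (L2_inner f g)) UNIV"
    by (simp add: algebra_simps)
  from has_sum_add[OF has_sum_of_real[OF Parseval_Re[OF f g]]
      has_sum_cmult_right[OF has_sum_of_real[OF Im], of \<i>]]
  show ?thesis
    by (simp only: complex_eq[symmetric])
qed

subsection \<open>Weak derivatives and the operators \<open>\<A>\<^sub>L\<close> and \<open>\<B>\<^sub>L\<close>\<close>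

text \<open>Test the defining identity with the character \<open>echar (- k)\<close>.\<close>

lemma has_weak_partial_coeff:
  assumes "has_weak_partial j f g"
  shows "fourier_coeff g k = 2 * pi * \<i> * (k $ j) * fourier_coeff f k"
proof -
  have "(LINT x|torus_measure. f x * classical_partial j (echar (- k)) x)
      = - (LINT x|torus_measure. g x * echar (- k) x)"
    using assms test_function_echar by (auto simp: has_weak_partial_def)
  moreover have "(LINT x|torus_measure. f x * classical_partial j (echar (- k)) x)
      = - (2 * pi * \<i> * (k $ j)) * (LINT x|torus_measure. f x * echar (- k) x)"
    using classical_partial_echar[of j 1 "- k"]
    by (simp add: mult.left_commute flip: integral_mult_right_zero)
  ultimately show ?thesis
    by (simp add: fourier_coeff_eq_inner L2_inner_def cnj_echar)
qed

text \<open>Parseval turns both integrals into series, which agree term by term: differentiating the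
  test function multiplies its coefficient at \<open>- k\<close> by
  \<open>- 2 pi i k_j\<close>.\<close>

lemma has_weak_partialI:
  assumes f: "f \<in> L2_torus" and g: "g \<in> L2_torus"
    and coeff: "\<And>k. fourier_coeff g k = 2 * pi * \<i> * (k $ j) * fourier_coeff f k"
  shows "has_weak_partial j f g"
  unfolding has_weak_partial_def
proof (intro conjI allI impI g)
  fix \<phi> :: "real^'a \<Rightarrow> complex" assume \<phi>: "test_function \<phi>"
  \<comment> \<open>The pairing is bilinear, so Parseval is applied to the conjugate of
    \<open>q\<close>; this reflects the index to \<open>- k\<close>.\<close>
  have pair: "((\<lambda>k. fourier_coeff p k * fourier_coeff q (- k)) has_sum (LINT x|torus_measure. p x * q x)) UNIV"
    if "p \<in> L2_torus" "q \<in> L2_torus" for p q :: "real^'a \<Rightarrow> complex"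
    using Parseval_inner[OF that(1) L2_cnj[OF that(2)]]
    by (simp add: fourier_coeff_cnj L2_inner_def)
  have "((\<lambda>k. - (fourier_coeff g k * fourier_coeff \<phi> (- k))) has_sum - (LINT x|torus_measure. g x * \<phi> x)) UNIV"
    unfolding has_sum_uminus using pair[OF g L2_test_function[OF \<phi>]] by simp
  moreover have "- (fourier_coeff g k * fourier_coeff \<phi> (- k))
      = fourier_coeff f k * fourier_coeff (classical_partial j \<phi>) (- k)" for k
    by (simp add: coeff fourier_coeff_classical_partial[OF \<phi>])
  ultimately show "(LINT x|torus_measure. f x * classical_partial j \<phi> x) = - (LINT x|torus_measure. g x * \<phi> x)"
    using pair[OF f L2_classical_partial[OF \<phi>, of j]] by (simp add: has_sum_unique)
qed

lemma H1_torusD: "f \<in> H1_torus \<Longrightarrow> f \<in> L2_torus"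
  by (simp add: H1_torus_def)

text \<open>The prescribed coefficients are square summable because \<open>|k_j|\<close> is at most
  the norm of \<open>k\<close>; Riesz-Fischer realises them.\<close>

lemma weak_partial_exists:
  assumes "f \<in> H1_torus"
  shows "\<exists>g. has_weak_partial j f g"
proof -
  have "(\<lambda>k. (cmod (2 * pi * \<i> * (k $ j) * fourier_coeff f k))\<^sup>2) summable_on UNIV"
  proof (rule summable_on_comparison_test)
    show "(\<lambda>k. (2 * pi)\<^sup>2 * ((norm (rvec k))\<^sup>2 * (cmod (fourier_coeff f k))\<^sup>2)) summable_on UNIV"
      using assms by (intro summable_on_cmult_right) (simp add: H1_torus_def)
    fix k :: "int^'a"
    have "\<bar>real_of_int (k $ j)\<bar> \<le> norm (rvec k)"
      using component_le_norm_cart[of "rvec k" j] by simp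
    then have "(real_of_int (k $ j))\<^sup>2 \<le> (norm (rvec k))\<^sup>2"
      using power_mono[of "\<bar>real_of_int (k $ j)\<bar>" _ 2] by simp
    then show "(cmod (2 * pi * \<i> * (k $ j) * fourier_coeff f k))\<^sup>2
        \<le> (2 * pi)\<^sup>2 * ((norm (rvec k))\<^sup>2 * (cmod (fourier_coeff f k))\<^sup>2)"
      by (simp add: norm_mult power_mult_distrib mult_right_mono)
  qed simp
  then obtain g where "g \<in> L2_torus" "fourier_coeff g = (\<lambda>k. 2 * pi * \<i> * (k $ j) * fourier_coeff f k)"
    by (rule Riesz_Fischer)
  then show ?thesis
    using has_weak_partialI[OF H1_torusD[OF assms], of g j] by auto
qed

lemma has_weak_partial_unique:
  assumes "has_weak_partial j f g" "has_weak_partial j f h"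
  shows "AE x in torus_measure. g x = h x"
proof (rule fourier_coeff_unique)
  show "g \<in> L2_torus" "h \<in> L2_torus"
    using assms by (simp_all add: has_weak_partial_def)
  show "fourier_coeff g = fourier_coeff h"
    using assms by (auto simp: has_weak_partial_coeff)
qed

text \<open>Equality of the predicates makes the choice in \<open>weak_partial\<close> pick the same
  representative, so \<open>op_B\<close> yields identical functions.\<close>

lemma has_weak_partial_cong_AE:
  assumes "f \<in> L2_torus" "g \<in> L2_torus" "AE x in torus_measure. f x = g x"
  shows "has_weak_partial j f = has_weak_partial j g"
proof -
  have "(LINT x|torus_measure. f x * classical_partial j \<phi> x) = (LINT x|torus_measure. g x * classical_partial j \<phi> x)"
    if \<phi>: "test_function \<phi>" for \<phi>
    using assms L2_integrable_mult[OF _ L2_classical_partial[OF \<phi>, of j]]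
    by (intro integral_cong_AE borel_measurable_integrable) auto
  then show ?thesis
    by (auto simp: has_weak_partial_def fun_eq_iff)
qed

lemma op_B_cong_AE:
  assumes "f \<in> L2_torus" "g \<in> L2_torus" "AE x in torus_measure. f x = g x"
  shows "op_B L f = op_B L g"
  by (simp add: op_B_def dir_deriv_def weak_partial_def has_weak_partial_cong_AE[OF assms] fun_eq_iff)

section \<open>The two operators on the Fourier side\<close>

lemma op_A_eq_echar: "op_A L f = (\<lambda>x. echar L x * f x)"
  by (simp add: op_A_def echar_def fun_eq_iff)

lemma L2_op_A:
  assumes "f \<in> L2_torus"
  shows "op_A L f \<in> L2_torus"
proof (rule L2_torusI)
  show "periodic (op_A L f)"
    using L2_torusD(1)[OF assms] periodic_echar[of L]
    by (simp add: op_A_eq_echar periodic_def)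
  show "op_A L f \<in> borel_measurable torus_measure"
    unfolding op_A_eq_echar
    by (intro borel_measurable_times continuous_measurable_torus continuous_echar L2_torusD(2) assms)
  show "integrable torus_measure (\<lambda>x. (cmod (op_A L f x))\<^sup>2)"
    using L2_torusD(3)[OF assms] by (simp add: op_A_eq_echar norm_mult)
qed

lemma L2_norm_op_A: "L2_norm (op_A L f) = L2_norm f"
  by (simp add: L2_norm_def op_A_eq_echar norm_mult)

lemma L2_inner_op_A: "L2_inner (op_A L f) g = L2_inner f (op_A (- L) g)"
  by (simp add: L2_inner_def op_A_eq_echar mult_ac flip: cnj_echar)

lemma fourier_coeff_op_A: "fourier_coeff (op_A L f) k = fourier_coeff f (k - L)"
proof -
  have "op_A (- L) (echar k) = echar (k - L)"
    unfolding op_A_eq_echar by (simp flip: echar_add)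
  then show ?thesis
    by (simp add: fourier_coeff_eq_inner L2_inner_op_A)
qed

lemma L2_dir_deriv:
  assumes "f \<in> H1_torus"
  shows "dir_deriv L f \<in> L2_torus"
    and "fourier_coeff (dir_deriv L f) k = 2 * pi * \<i> * (rvec L \<bullet> rvec k) * fourier_coeff f k"
proof -
  have wp: "has_weak_partial j f (weak_partial j f)" for j
    unfolding weak_partial_def using weak_partial_exists[OF assms] by (rule someI_ex)
  then have L2: "(\<lambda>x. of_int (L $ j) * weak_partial j f x) \<in> L2_torus" for j
    by (intro L2_scale) (simp add: has_weak_partial_def)
  then show "dir_deriv L f \<in> L2_torus"
    unfolding dir_deriv_def[abs_def] by (rule L2_sum)
  have "fourier_coeff (dir_deriv L f) k
      = (\<Sum>j\<in>UNIV. fourier_coeff (\<lambda>x. of_int (L $ j) * weak_partial j f x) k)"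
    unfolding dir_deriv_def[abs_def] fourier_coeff_eq_inner
    using L2 by (intro L2_inner_sum_left L2_echar)
  also have "\<dots> = 2 * pi * \<i> * (rvec L \<bullet> rvec k) * fourier_coeff f k"
    unfolding fourier_coeff_scale has_weak_partial_coeff[OF wp]
    by (simp add: inner_vec_def sum_distrib_left sum_distrib_right mult_ac)
  finally show "fourier_coeff (dir_deriv L f) k = 2 * pi * \<i> * (rvec L \<bullet> rvec k) * fourier_coeff f k" .
qed

lemma L2_op_B: "f \<in> H1_torus \<Longrightarrow> op_B L f \<in> L2_torus"
  unfolding op_B_def[abs_def] by (intro L2_scale L2_dir_deriv)

text \<open>The sign arises from the product of \<open>\<i> / (2 pi)\<close> and
  \<open>2 pi \<i>\<close>.\<close>

lemma fourier_coeff_op_B: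
  "f \<in> H1_torus \<Longrightarrow> fourier_coeff (op_B L f) k = - of_real (rvec L \<bullet> rvec k) * fourier_coeff f k"
  unfolding op_B_def[abs_def] fourier_coeff_scale by (simp add: L2_dir_deriv)

subsection \<open>The uncertainty inequality\<close>

lemma UP_cong_AE:
  assumes "f \<in> H1_torus" "g \<in> L2_torus" "AE x in torus_measure. g x = f x"
  shows "UP L g = UP L f"
proof -
  have f: "f \<in> L2_torus" using assms(1) by (rule H1_torusD)
  have B: "op_B L g = op_B L f"
    using assms f by (intro op_B_cong_AE)
  have N: "L2_norm g = L2_norm f"
    using assms f by (intro L2_norm_cong_AE)
  have right: "L2_inner h g = L2_inner h f" if "h \<in> L2_torus" for h
    using L2_inner_cong_AE[OF assms(2) f that assms(3)] by (metis L2_inner_cnj)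
  have "L2_inner (op_A L g) g = L2_inner (op_A L f) g"
    using assms f by (intro L2_inner_cong_AE L2_op_A) (auto simp: op_A_eq_echar)
  with right[OF L2_op_A[OF f]] right[OF L2_op_B[OF assms(1)]] show ?thesis
    by (simp add: UP_def B N)
qed

text \<open>The function \<open>r\<close> is the component of \<open>g\<close> orthogonal to
  \<open>f\<close>, and its norm is Pythagoras. Applied to the images of \<open>f\<close> under the
  operators, it produces the variances in the uncertainty product.\<close>

lemma L2_residual:
  fixes f g :: "real^'d \<Rightarrow> complex"
  assumes f: "f \<in> L2_torus" and g: "g \<in> L2_torus" and nz: "L2_norm f \<noteq> 0"
  defines "r \<equiv> (\<lambda>x. g x - L2_inner g f / of_real ((L2_norm f)\<^sup>2) * f x)"
  shows "r \<in> L2_torus" "L2_inner r f = 0"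
    "(L2_norm r)\<^sup>2 = (L2_norm g)\<^sup>2 - (cmod (L2_inner g f))\<^sup>2 / (L2_norm f)\<^sup>2"
proof -
  define a where "a = L2_inner g f / of_real ((L2_norm f)\<^sup>2)"
  have r: "r = (\<lambda>x. g x - a * f x)" by (simp add: r_def a_def)
  have af: "(\<lambda>x. a * f x) \<in> L2_torus" using f by (rule L2_scale)
  show r_L2: "r \<in> L2_torus"
    unfolding r using g af by (rule L2_diff)
  show rf: "L2_inner r f = 0"
    unfolding r L2_inner_diff_left[OF g af f] L2_inner_scale_left L2_inner_self
    using nz by (simp add: a_def)
  \<comment> \<open>Only the second argument is expanded, so that orthogonality leaves the inner
    product of \<open>r\<close> with \<open>g\<close>.\<close>
  have "complex_of_real ((L2_norm r)\<^sup>2) = L2_inner r g - cnj a * L2_inner r f"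
    unfolding L2_inner_self[symmetric]
    by (subst (2) r) (simp add: L2_inner_diff_right[OF g af r_L2] L2_inner_scale_right)
  also have "\<dots> = L2_inner g g - a * L2_inner f g"
    unfolding rf by (simp add: r L2_inner_diff_left[OF g af g] L2_inner_scale_left)
  also have "\<dots> = of_real ((L2_norm g)\<^sup>2 - (cmod (L2_inner g f))\<^sup>2 / (L2_norm f)\<^sup>2)"
    by (simp add: L2_inner_self a_def complex_norm_square L2_inner_cnj del: of_real_power)
  finally show "(L2_norm r)\<^sup>2 = (L2_norm g)\<^sup>2 - (cmod (L2_inner g f))\<^sup>2 / (L2_norm f)\<^sup>2"
    by (simp only: of_real_eq_iff)
qed

text \<open>On the Fourier side \<open>op_B\<close> multiplies by a real number, so every term of
  the Parseval series is real.\<close>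

lemma inner_op_B_has_sum:
  fixes f :: "real^'d \<Rightarrow> complex"
  assumes "f \<in> H1_torus"
  shows "((\<lambda>k. (rvec L \<bullet> rvec k) * (cmod (fourier_coeff f k))\<^sup>2) has_sum - Re (L2_inner (op_B L f) f)) UNIV"
    and "Im (L2_inner (op_B L f) f) = 0"
proof -
  have sum: "((\<lambda>k. fourier_coeff (op_B L f) k * cnj (fourier_coeff f k)) has_sum L2_inner (op_B L f) f) UNIV"
    using assms by (intro Parseval_inner L2_op_B H1_torusD)
  have eq: "fourier_coeff (op_B L f) k * cnj (fourier_coeff f k)
      = complex_of_real (- ((rvec L \<bullet> rvec k) * (cmod (fourier_coeff f k))\<^sup>2))" for k
    by (simp add: fourier_coeff_op_B[OF assms] complex_norm_square del: of_real_power)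
  from has_sum_Re[OF sum] have "((\<lambda>k. - ((rvec L \<bullet> rvec k) * (cmod (fourier_coeff f k))\<^sup>2))
      has_sum Re (L2_inner (op_B L f) f)) UNIV"
    unfolding eq by (simp only: Re_complex_of_real)
  from has_sum_uminus[THEN iffD1, OF this]
  show "((\<lambda>k. (rvec L \<bullet> rvec k) * (cmod (fourier_coeff f k))\<^sup>2) has_sum - Re (L2_inner (op_B L f) f)) UNIV"
    by simp
  from has_sum_Im[OF sum] have "((\<lambda>k :: int^'d. 0) has_sum Im (L2_inner (op_B L f) f)) UNIV"
    unfolding eq by (simp only: Im_complex_of_real)
  from has_sum_unique[OF this has_sum_0] show "Im (L2_inner (op_B L f) f) = 0"
    by simp
qed

lemma norm_op_B_has_sum:
  assumes "f \<in> H1_torus"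
  shows "((\<lambda>k. (rvec L \<bullet> rvec k)\<^sup>2 * (cmod (fourier_coeff f k))\<^sup>2) has_sum (L2_norm (op_B L f))\<^sup>2) UNIV"
  using Parseval[OF L2_op_B[OF assms, of L]]
  by (simp add: fourier_coeff_op_B[OF assms] norm_mult power_mult_distrib)

text \<open>The commutator relation \<open>[\<A>\<^sub>L, \<B>\<^sub>L] = \<parallel>L\<parallel>\<^sup>2 \<A>\<^sub>L\<close>, tested against \<open>f\<close>.\<close>
lemma commutator_op_A_op_B:
  assumes "f \<in> H1_torus"
  shows "L2_inner (op_A L (op_B L f)) f - L2_inner (op_A L f) (op_B L f)
    = of_real ((norm (rvec L))\<^sup>2) * L2_inner (op_A L f) f"
proof -
  let ?c = "fourier_coeff f"
  note L2 = H1_torusD[OF assms] L2_op_B[OF assms]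
  have "((\<lambda>k. fourier_coeff (op_A L (op_B L f)) k * cnj (?c k)
        + (- 1) * (fourier_coeff (op_A L f) k * cnj (fourier_coeff (op_B L f) k)))
      has_sum (L2_inner (op_A L (op_B L f)) f + (- 1) * L2_inner (op_A L f) (op_B L f))) UNIV"
    by (intro has_sum_add has_sum_cmult_right Parseval_inner L2_op_A L2)
  \<comment> \<open>The multipliers of \<open>op_B\<close> are evaluated at \<open>k - L\<close> in
    the first term and at \<open>k\<close> in the second; they differ by the inner product of
    \<open>L\<close> with itself.\<close>
  moreover have "fourier_coeff (op_A L (op_B L f)) k * cnj (?c k)
        + (- 1) * (fourier_coeff (op_A L f) k * cnj (fourier_coeff (op_B L f) k))
      = of_real ((norm (rvec L))\<^sup>2) * (fourier_coeff (op_A L f) k * cnj (?c k))" for k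
    unfolding fourier_coeff_op_A fourier_coeff_op_B[OF assms] power2_norm_eq_inner
    by (simp add: inner_diff_right algebra_simps)
  moreover have "((\<lambda>k. of_real ((norm (rvec L))\<^sup>2) * (fourier_coeff (op_A L f) k * cnj (?c k)))
      has_sum of_real ((norm (rvec L))\<^sup>2) * L2_inner (op_A L f) f) UNIV"
    by (intro has_sum_cmult_right Parseval_inner L2_op_A L2)
  ultimately have "L2_inner (op_A L (op_B L f)) f + (- 1) * L2_inner (op_A L f) (op_B L f)
      = of_real ((norm (rvec L))\<^sup>2) * L2_inner (op_A L f) f"
    by (simp only: has_sum_unique)
  then show ?thesis by simp
qed

text \<open>Both factors of \<open>UP\<close> are squared norms of residuals up to factors that
  cancel, so the bound reduces to Cauchy-Schwarz for the commutator.\<close>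

lemma UP_ge_quarter:
  assumes f1: "f \<in> H1_torus" and L: "L \<noteq> 0" and w: "L2_inner (op_A L f) f \<noteq> 0"
    and nz: "L2_norm f \<noteq> 0"
  shows "UP L f \<ge> 1 / 4"
proof -
  define S where "S = (L2_norm f)\<^sup>2"
  define w where "w = L2_inner (op_A L f) f"
  define \<rho> where "\<rho> = L2_inner (op_B L f) f / of_real S"
  define u where "u x = op_A L f x - L2_inner (op_A L f) f / of_real S * f x" for x
  define v where "v x = op_A (- L) f x - L2_inner (op_A (- L) f) f / of_real S * f x" for x
  define D where "D x = op_B L f x - \<rho> * f x" for x
  have f: "f \<in> L2_torus" using f1 by (rule H1_torusD)
  have A: "op_A L f \<in> L2_torus" and A': "op_A (- L) f \<in> L2_torus" and B: "op_B L f \<in> L2_torus"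
    using f f1 by (auto intro: L2_op_A L2_op_B)
  have \<rho>f: "(\<lambda>x. \<rho> * f x) \<in> L2_torus" using f by (rule L2_scale)
  have S: "S > 0" using nz by (simp add: S_def)
  note u = L2_residual[OF f A nz, folded S_def, folded u_def]
  note v = L2_residual[OF f A' nz, folded S_def, folded v_def]
  note D = L2_residual[OF f B nz, folded S_def, folded \<rho>_def, folded D_def]
  have fD: "L2_inner f D = 0"
    using D(2) L2_inner_cnj[of D f] by simp
  have Af: "L2_inner (op_A (- L) f) f = cnj w"
    unfolding w_def L2_inner_op_A[of "- L"] by (simp add: L2_inner_cnj)
  \<comment> \<open>Reality of the mean gives the next two inner products the same correction
    \<open>\<rho> * w\<close>, which cancels in their difference.\<close>
  have \<rho>: "cnj \<rho> = \<rho>"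
    using inner_op_B_has_sum(2)[OF f1, of L] by (simp add: \<rho>_def complex_eq_iff)
  have uD: "L2_inner u D = L2_inner (op_A L f) (op_B L f) - \<rho> * w"
  proof -
    have "L2_inner u D = L2_inner (op_A L f) D"
      unfolding u_def[abs_def] L2_inner_diff_left[OF A L2_scale[OF f] D(1)] L2_inner_scale_left fD
      by simp
    also have "\<dots> = L2_inner (op_A L f) (op_B L f) - \<rho> * w"
      unfolding D_def[abs_def] L2_inner_diff_right[OF B \<rho>f A] L2_inner_scale_right \<rho> w_def by simp
    finally show ?thesis .
  qed
  have Dv: "L2_inner D v = L2_inner (op_A L (op_B L f)) f - \<rho> * w"
  proof -
    have "L2_inner D v = L2_inner D (op_A (- L) f)"
      unfolding v_def[abs_def] L2_inner_diff_right[OF A' L2_scale[OF f] D(1)] L2_inner_scale_right D(2)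
      by simp
    also have "\<dots> = L2_inner (op_A L (op_B L f)) f - \<rho> * w"
      unfolding D_def[abs_def] L2_inner_diff_left[OF B \<rho>f A'] L2_inner_scale_left w_def
      by (simp add: L2_inner_op_A)
    finally show ?thesis .
  qed
  \<comment> \<open>Multiplication by a character preserves the norm, and the two means
    \<open>w\<close> and \<open>cnj w\<close> have equal modulus.\<close>
  have norm_uv: "L2_norm v = L2_norm u"
    by (rule power2_eq_imp_eq) (simp_all add: u(3) v(3) Af L2_norm_op_A w_def[symmetric])
  have "(norm (rvec L))\<^sup>2 * cmod w = cmod (L2_inner D v - L2_inner u D)"
    using commutator_op_A_op_B[OF f1, of L] by (simp add: uD Dv w_def norm_mult norm_power)
  also have "\<dots> \<le> cmod (L2_inner D v) + cmod (L2_inner u D)"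
    by (rule norm_triangle_ineq4)
  also have "\<dots> \<le> L2_norm D * L2_norm v + L2_norm u * L2_norm D"
    by (intro add_mono L2_Cauchy_Schwarz u v D)
  also have "\<dots> = 2 * (L2_norm u * L2_norm D)"
    by (simp add: norm_uv)
  finally have "((norm (rvec L))\<^sup>2 * cmod w)\<^sup>2 \<le> (2 * (L2_norm u * L2_norm D))\<^sup>2"
    by (rule power_mono) simp
  then have key: "norm (rvec L) ^ 4 * (cmod w)\<^sup>2 \<le> 4 * ((L2_norm u)\<^sup>2 * (L2_norm D)\<^sup>2)"
    by (simp add: power_mult_distrib flip: power_mult)
  have pos: "norm (rvec L) ^ 4 * (cmod w)\<^sup>2 > 0"
    using L w by (simp add: rvec_eq_0_iff w_def)
  have N4: "L2_norm f ^ 4 = S\<^sup>2" by (simp add: S_def flip: power_mult)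
  have "UP L f = ((L2_norm u)\<^sup>2 * (L2_norm D)\<^sup>2) / (norm (rvec L) ^ 4 * (cmod w)\<^sup>2)"
  proof -
    have "S\<^sup>2 / (cmod w)\<^sup>2 - 1 = S * (L2_norm u)\<^sup>2 / (cmod w)\<^sup>2"
      unfolding u(3) L2_norm_op_A w_def[symmetric] S_def[symmetric]
      using S w by (simp add: w_def[symmetric] field_simps power2_eq_square)
    moreover have "(L2_norm (op_B L f))\<^sup>2 / S - (cmod (L2_inner (op_B L f) f))\<^sup>2 / S\<^sup>2 = (L2_norm D)\<^sup>2 / S"
      unfolding D(3) using S by (simp add: field_simps power2_eq_square)
    ultimately show ?thesis
      unfolding UP_def N4 w_def[symmetric] S_def[symmetric] using S by simp
  qed
  also have "\<dots> \<ge> 1 / 4"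
    using key pos by (simp add: pos_le_divide_eq)
  finally show ?thesis .
qed

text \<open>Summability is asserted beside the formula because \<open>infsum\<close> of a
  non-summable family is 0 by convention, so the formula alone would not express
  convergence.\<close>

theorem theorem3:
  fixes L :: "int^'d" and f :: "real^'d \<Rightarrow> complex"
  defines "c \<equiv> fourier_coeff f"
  assumes "L \<noteq> 0"
    and "f \<in> H1_torus"
    and "L2_inner (op_A L f) f \<noteq> 0"
  shows "UP_well_defined L f
    \<and> (\<lambda>k. (cmod (c k))\<^sup>2) summable_on UNIV
    \<and> (\<lambda>k. c (k - L) * cnj (c k)) summable_on UNIV
    \<and> (\<lambda>k. (rvec L \<bullet> rvec k)\<^sup>2 * (cmod (c k))\<^sup>2) summable_on UNIV
    \<and> (\<lambda>k. (rvec L \<bullet> rvec k) * (cmod (c k))\<^sup>2) summable_on UNIV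
    \<and> UP L f = 1 / norm (rvec L) ^ 4
        * ((\<Sum>\<^sub>\<infinity>k. (cmod (c k))\<^sup>2)\<^sup>2 / (cmod (\<Sum>\<^sub>\<infinity>k. c (k - L) * cnj (c k)))\<^sup>2 - 1)
        * ((\<Sum>\<^sub>\<infinity>k. (rvec L \<bullet> rvec k)\<^sup>2 * (cmod (c k))\<^sup>2) / (\<Sum>\<^sub>\<infinity>k. (cmod (c k))\<^sup>2)
           - ((\<Sum>\<^sub>\<infinity>k. (rvec L \<bullet> rvec k) * (cmod (c k))\<^sup>2) / (\<Sum>\<^sub>\<infinity>k. (cmod (c k))\<^sup>2))\<^sup>2)
    \<and> UP L f \<ge> 1 / 4"
proof -
  have f: "f \<in> L2_torus" using assms(3) by (rule H1_torusD)
  have A: "op_A L f \<in> L2_torus" using f by (rule L2_op_A)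
  have B: "op_B L f \<in> L2_torus" using assms(3) by (rule L2_op_B)
  \<comment> \<open>If \<open>f\<close> had norm 0, Cauchy-Schwarz would make the inner product with
    \<open>op_A L f\<close> vanish.\<close>
  have nz: "L2_norm f \<noteq> 0"
    using L2_Cauchy_Schwarz[OF A f] assms(4) by auto
  have sum_c: "((\<lambda>k. (cmod (c k))\<^sup>2) has_sum (L2_norm f)\<^sup>2) UNIV"
    unfolding c_def using f by (rule Parseval)
  have sum_A: "((\<lambda>k. c (k - L) * cnj (c k)) has_sum L2_inner (op_A L f) f) UNIV"
    using Parseval_inner[OF A f] by (simp add: c_def fourier_coeff_op_A)
  have sum_B2: "((\<lambda>k. (rvec L \<bullet> rvec k)\<^sup>2 * (cmod (c k))\<^sup>2) has_sum (L2_norm (op_B L f))\<^sup>2) UNIV"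
    unfolding c_def using assms(3) by (rule norm_op_B_has_sum)
  have sum_B: "((\<lambda>k. (rvec L \<bullet> rvec k) * (cmod (c k))\<^sup>2) has_sum - Re (L2_inner (op_B L f) f)) UNIV"
    unfolding c_def using assms(3) by (rule inner_op_B_has_sum)
  have "UP_well_defined L f"
    unfolding UP_well_defined_def
  proof (intro conjI allI impI ballI f A B nz assms(4) L2_integrable_inner)
    show "\<exists>g. has_weak_partial j f g" for j
      using assms(3) by (rule weak_partial_exists)
    show "AE x in torus_measure. g x = h x" if "has_weak_partial j f g" "has_weak_partial j f h" for j g h
      using that by (rule has_weak_partial_unique)
    show "norm (rvec L) \<noteq> 0"
      using assms(2) by (simp add: rvec_eq_0_iff)
    show "UP L f' = UP L f" if "f' \<in> L2_torus" "AE x in torus_measure. f' x = f x" for f'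
      using assms(3) that by (rule UP_cong_AE)
  qed
  \<comment> \<open>The mean of \<open>op_B\<close> is real, so its squared modulus is the square of
    its real part, and the minus sign disappears in the square.\<close>
  moreover have "UP L f = 1 / norm (rvec L) ^ 4
      * (((L2_norm f)\<^sup>2)\<^sup>2 / (cmod (L2_inner (op_A L f) f))\<^sup>2 - 1)
      * ((L2_norm (op_B L f))\<^sup>2 / (L2_norm f)\<^sup>2
         - (- Re (L2_inner (op_B L f) f) / (L2_norm f)\<^sup>2)\<^sup>2)"
    using inner_op_B_has_sum(2)[OF assms(3), of L]
    by (simp add: UP_def cmod_power2 power_divide flip: power_mult)
  moreover note UP_ge_quarter[OF assms(3,2,4) nz]
  ultimately show ?thesis
    unfolding infsumI[OF sum_c] infsumI[OF sum_A] infsumI[OF sum_B2] infsumI[OF sum_B]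
    using has_sum_imp_summable[OF sum_c] has_sum_imp_summable[OF sum_A]
      has_sum_imp_summable[OF sum_B2] has_sum_imp_summable[OF sum_B]
    by (intro conjI)
qed

end
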